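(* A permutation $\alpha$ is an even thread of nonnegative length if and only if there are an even thread $\alpha_1$ and an odd thread $\beta_1$ with $$\alpha = c(\beta_1)\ominus 1\ominus \alpha_1 .$$ Similarly, a permutation $\beta$ is an odd thread of positive length if and only if there are an even thread $\alpha_2$ and an odd thread $\beta_2$ with $$\beta = (1\oplus c(\alpha_2)\oplus 1)\ominus \beta_2 .$$
   Context: Permutations are written in one-line notation; $S_n$ is the set of permutations of $\{1,\dots,n\}$, $|\pi|$ is the length of $\pi$, and $1$ denotes the permutation of length one. For $\pi\in S_n$ the complement $c(\pi)\in S_n$ is $c(\pi)(j)=n+1-\pi(j)$. For $\pi\in S_n$, $\sigma\in S_m$: $\pi\oplus\sigma\in S_{n+m}$ has $(\pi\oplus\sigma)(j)=\pi(j)$ for $j\le n$ and $n+\sigma(j-n)$ for $j>n$; $\pi\ominus\sigma\in S_{n+m}$ has $(\pi\ominus\sigma)(j)=m+\pi(j)$ for $j\le n$ and $\sigma(j-n)$ for $j>n$. $\emptyset$ is the empty permutation (length $0$), an identity for $\oplus$ and $\ominus$. $@$ is a formal symbol, the "antipermutation", regarded as the unique permutation of length $-1$, with $c(@)=@$, $1\oplus @=@\oplus 1=1\ominus @=@\ominus 1=\emptyset$ and $\emptyset\ominus @=@\ominus\emptyset=@$; in an iterated sum each $@$ is combined with an adjacent $1$ first (so $1\oplus @\oplus 1=1$, $\sigma\ominus 1\ominus @=\sigma$, $@\ominus 1\ominus\sigma=\sigma$). The permutation induced by $\pi$ on a set of its entries is the standardization of the corresponding subsequence. A complete Baxter permutation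 is a permutation $\pi$ of length $2n+1$ such that $\pi(i)$ is even iff $i$ is even, and whenever $\pi(x)=i$, $\pi(y)=i+1$ and $z$ lies strictly between $x$ and $y$, then $\pi(z)<i$ if $i$ is odd and $\pi(z)>i+1$ if $i$ is even. A permutation is alternating if it begins with an ascent and its ascents and descents alternate; it is doubly alternating if it and its inverse are alternating (permutations of length $\le 1$ are doubly alternating). A permutation $\sigma$ of length $n\ge 0$ is a snow leopard permutation if there is a complete Baxter permutation of length $2n+1$ whose even entries induce $\sigma$ and whose odd entries induce a doubly alternating permutation (of length $n+1$). By convention $@$ is also a snow leopard permutation; "odd length" includes length $-1$. Snow leopard permutations preserve parity ($\pi(j)$ is even iff $j$ is even). For a parity-preserving $\pi$, $\pi^e$ and $\pi^o$ are the permutations induced by $\pi$ on its even and odd entries; if $|\pi|=2n+1\ge 1$ then $|\pi^e|=n$, $|\pi^o|=n+1$. By convention $@^e=@$, $@^o=\emptyset$. An even thread (resp. odd thread) is a permutation of the form $\pi^e$ (resp. $\pi^o$) for some snow leopard permutation $\pi$ of odd length. *)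

theory Defs
  imports Main "HOL-Combinatorics.Multiset_Permutations"
begin

text \<open>
  A permutation of \<open>{1..n}\<close> is represented by its one-line notation, a list of naturals.
  \<open>entry p j\<close> is the value at the 1-based position \<open>j\<close>.
\<close>

definition is_perm :: "nat list \<Rightarrow> bool" where
  "is_perm p \<longleftrightarrow> p \<in> permutations_of_set {1..length p}"

definition entry :: "nat list \<Rightarrow> nat \<Rightarrow> nat" where
  "entry p j = p ! (j - 1)"

definition inverse_perm :: "nat list \<Rightarrow> nat list" where
  "inverse_perm p = map (inv_into {1..length p} (entry p)) [1..<length p + 1]"

definition standardization :: "nat list \<Rightarrow> nat list" where
  "standardization xs = map (\<lambda>v. card {w \<in> set xs. w \<le> v}) xs"

definition even_part :: "nat list \<Rightarrow> nat list" where
  "even_part p = standardization (filter even p)"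

definition odd_part :: "nat list \<Rightarrow> nat list" where
  "odd_part p = standardization (filter odd p)"

definition complete_baxter :: "nat list \<Rightarrow> bool" where
  "complete_baxter p \<longleftrightarrow>
     is_perm p \<and> odd (length p) \<and>
     (\<forall>i\<in>{1..length p}. even (entry p i) \<longleftrightarrow> even i) \<and>
     (\<forall>x\<in>{1..length p}. \<forall>y\<in>{1..length p}. \<forall>z\<in>{1..length p}. \<forall>i.
        entry p x = i \<and> entry p y = i + 1 \<and> (x < z \<and> z < y \<or> y < z \<and> z < x) \<longrightarrow>
          (odd i \<longrightarrow> entry p z < i) \<and> (even i \<longrightarrow> entry p z > i + 1))"

definition ascent :: "nat list \<Rightarrow> nat \<Rightarrow> bool" where
  "ascent p i \<longleftrightarrow> entry p i < entry p (i + 1)"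

definition descent :: "nat list \<Rightarrow> nat \<Rightarrow> bool" where
  "descent p i \<longleftrightarrow> entry p i > entry p (i + 1)"

definition alternating :: "nat list \<Rightarrow> bool" where
  "alternating p \<longleftrightarrow>
     (2 \<le> length p \<longrightarrow> ascent p 1) \<and>
     (\<forall>i. 1 \<le> i \<and> i + 2 \<le> length p \<longrightarrow> (ascent p i \<longleftrightarrow> descent p (i + 1)))"

definition doubly_alternating :: "nat list \<Rightarrow> bool" where
  "doubly_alternating p \<longleftrightarrow> alternating p \<and> alternating (inverse_perm p)"

text \<open>
  \<open>Anti\<close> is the antipermutation, the formal permutation of length \<open>-1\<close>.
\<close>

datatype xperm = Anti | Perm "nat list"

primrec extended_perm :: "xperm \<Rightarrow> bool" where
  "extended_perm Anti \<longleftrightarrow> True"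
| "extended_perm (Perm p) \<longleftrightarrow> is_perm p"

primrec plength :: "xperm \<Rightarrow> int" where
  "plength Anti = - 1"
| "plength (Perm p) = int (length p)"

primrec complement :: "xperm \<Rightarrow> xperm" where
  "complement Anti = Anti"
| "complement (Perm p) = Perm (map (\<lambda>v. length p + 1 - v) p)"

abbreviation one_perm :: xperm where
  "one_perm \<equiv> Perm [1]"

text \<open>
  The only sums involving \<open>Anti\<close> that have a meaning are those with the permutation of length one,
  which it cancels, and with the empty permutation, which is an identity; all others are left
  unspecified.  Consequently the operations are not associative in the presence of \<open>Anti\<close>, and
  iterated sums must be bracketed so that a possible \<open>Anti\<close> meets an adjacent \<open>one_perm\<close> first.
\<close>

fun direct_sum :: "xperm \<Rightarrow> xperm \<Rightarrow> xperm" (infixl "\<oplus>" 65) where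
  "Perm p \<oplus> Perm q = Perm (p @ map (\<lambda>v. length p + v) q)"
| "Perm p \<oplus> Anti = (if p = [1] then Perm [] else if p = [] then Anti else undefined)"
| "Anti \<oplus> Perm q = (if q = [1] then Perm [] else if q = [] then Anti else undefined)"
| "Anti \<oplus> Anti = undefined"

fun skew_sum :: "xperm \<Rightarrow> xperm \<Rightarrow> xperm" (infixl "\<ominus>" 65) where
  "Perm p \<ominus> Perm q = Perm (map (\<lambda>v. length q + v) p @ q)"
| "Perm p \<ominus> Anti = (if p = [1] then Perm [] else if p = [] then Anti else undefined)"
| "Anti \<ominus> Perm q = (if q = [1] then Perm [] else if q = [] then Anti else undefined)"
| "Anti \<ominus> Anti = undefined"

primrec snow_leopard :: "xperm \<Rightarrow> bool" where
  "snow_leopard Anti \<longleftrightarrow> True"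
| "snow_leopard (Perm s) \<longleftrightarrow>
     (\<exists>p. complete_baxter p \<and> length p = 2 * length s + 1 \<and>
          even_part p = s \<and> doubly_alternating (odd_part p))"

primrec evens :: "xperm \<Rightarrow> xperm" where
  "evens Anti = Anti"
| "evens (Perm p) = Perm (even_part p)"

primrec odds :: "xperm \<Rightarrow> xperm" where
  "odds Anti = Perm []"
| "odds (Perm p) = Perm (odd_part p)"

definition even_thread :: "xperm \<Rightarrow> bool" where
  "even_thread \<alpha> \<longleftrightarrow> (\<exists>\<pi>. snow_leopard \<pi> \<and> odd (plength \<pi>) \<and> \<alpha> = evens \<pi>)"

definition odd_thread :: "xperm \<Rightarrow> bool" where
  "odd_thread \<beta> \<longleftrightarrow> (\<exists>\<pi>. snow_leopard \<pi> \<and> odd (plength \<pi>) \<and> \<beta> = odds \<pi>)"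

end

theory Submission
  imports Defs
begin

text \<open>
  The theorem rests on a decomposition of the snow leopard permutations of odd length (with the
  antipermutation counted among them): they are the antipermutation and the permutations
  \<open>(1 \<oplus> c(\<pi>\<^sub>1) \<oplus> 1) \<ominus> 1 \<ominus> \<pi>\<^sub>2\<close> with \<open>\<pi>\<^sub>1\<close>, \<open>\<pi>\<^sub>2\<close> of the same kind.  Reading off the even and the odd
  entries of this sum (\<open>threads_of_composition\<close>) gives \<open>c(\<pi>\<^sub>1\<^sup>o) \<ominus> 1 \<ominus> \<pi>\<^sub>2\<^sup>e\<close> for the even thread and
  \<open>(1 \<oplus> c(\<pi>\<^sub>1\<^sup>e) \<oplus> 1) \<ominus> \<pi>\<^sub>2\<^sup>o\<close> for the odd thread.  As \<open>\<pi>\<^sub>1\<close> and \<open>\<pi>\<^sub>2\<close> are arbitrary and independent, and each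
  of the two formulas involves just one thread of each, both equivalences follow.

  The decomposition is proved for the underlying complete Baxter permutations, treated as functions
  on positions (locale \<open>alternating_baxter\<close>).  One has to show that such a permutation either begins with \<open>1\<close>
  or is a skew sum \<open>h \<ominus> 1 \<ominus> q\<close> cut at the value just below its first entry (\<open>skew_cut\<close>, the heart of the
  proof).  There the Baxter condition ties every even value to the odd value above it, even entries preserve residues
  modulo \<open>4\<close>, and counting residues left of the cut shows that the values there are closed under adding \<open>2\<close>.
  A permutation that begins with \<open>1\<close> ends with its maximum by symmetry, and then it is \<open>123\<close> or
  \<open>1 \<oplus> 1 \<oplus> c(q) \<oplus> 1 \<oplus> 1\<close> (\<open>frame_decomposition\<close>).  Conversely, both constructions preserve the
  defining conditions, which gives existence.
\<close>

section \<open>Alternating complete Baxter permutations\<close>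

text \<open>
  The function \<open>f\<close> gives the entries of a complete Baxter permutation of length \<open>M = 2 n + 1\<close> with
  \<open>n\<close> odd whose odd entries induce a doubly alternating permutation.  The odd entry at position
  \<open>2 i - 1\<close> represents the \<open>i\<close>-th entry of the induced permutation, so \<open>i\<close> is odd exactly when
  \<open>2 i - 1\<close> is congruent to \<open>1\<close> modulo \<open>4\<close>; the same holds for values.  Residues modulo \<open>4\<close> are
  written as divisibilities because these are what linear arithmetic decides quickly.
\<close>

locale alternating_baxter =
  fixes M :: nat and f :: "nat \<Rightarrow> nat"
  assumes len: "4 dvd M + 1"
    and bij: "bij_betw f {1..M} {1..M}"
    and parity: "x \<in> {1..M} \<Longrightarrow> even (f x) \<longleftrightarrow> even x"
    and below: "\<lbrakk>x \<in> {1..M}; y \<in> {1..M}; z \<in> {1..M}; f y = f x + 1; odd (f x);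
                  x < z \<and> z < y \<or> y < z \<and> z < x\<rbrakk> \<Longrightarrow> f z < f x"
    and above: "\<lbrakk>x \<in> {1..M}; y \<in> {1..M}; z \<in> {1..M}; f y = f x + 1; even (f x);
                  x < z \<and> z < y \<or> y < z \<and> z < x\<rbrakk> \<Longrightarrow> f y < f z"
    and columns: "\<lbrakk>odd x; x + 2 \<le> M\<rbrakk> \<Longrightarrow> f x < f (x + 2) \<longleftrightarrow> 4 dvd x + 3"
    and rows: "\<lbrakk>x \<in> {1..M}; y \<in> {1..M}; odd (f x); f y = f x + 2\<rbrakk> \<Longrightarrow> x < y \<longleftrightarrow> 4 dvd f x + 3"
begin

definition pos :: "nat \<Rightarrow> nat" where
  "pos = inv_into {1..M} f"

lemma M_ge_3: "3 \<le> M" and odd_M: "odd M"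
  using len by (presburger, presburger)

lemma f_range: "x \<in> {1..M} \<Longrightarrow> f x \<in> {1..M}"
  using bij bij_betwE by blast

lemma f_inj: "\<lbrakk>x \<in> {1..M}; y \<in> {1..M}\<rbrakk> \<Longrightarrow> f x = f y \<longleftrightarrow> x = y"
  using bij by (metis bij_betw_def inj_on_eq_iff)

lemma pos_range: "w \<in> {1..M} \<Longrightarrow> pos w \<in> {1..M}"
  unfolding pos_def using bij by (metis bij_betw_def inv_into_into)

lemma f_pos: "w \<in> {1..M} \<Longrightarrow> f (pos w) = w"
  unfolding pos_def using bij by (metis bij_betw_def f_inv_into_f)

lemma pos_f: "x \<in> {1..M} \<Longrightarrow> pos (f x) = x"
  unfolding pos_def using bij by (metis bij_betw_def inv_into_f_f)

lemma even_bounds: "\<lbrakk>x \<in> {1..M}; even x\<rbrakk> \<Longrightarrow> 2 \<le> x \<and> x + 1 \<le> M"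
  using odd_M by (cases "x = M") (auto simp: Suc_le_eq elim: evenE)

text \<open>
  If \<open>x\<close> did not lie between the positions \<open>l\<close> and \<open>r\<close> of the two adjacent values, then one of these
  would lie between \<open>x\<close> and the other, where the Baxter condition only tolerates values on the
  opposite side of \<open>f x\<close>.
\<close>

lemma crossing:
  assumes x: "x \<in> {1..M}" "even x"
  obtains l r where "l \<in> {1..M}" "r \<in> {1..M}" "f x = f l + 1" "f r = f x + 1" "odd (f l)"
    "if 4 dvd f x then r < x \<and> x < l else l < x \<and> x < r"
proof -
  have ev: "even (f x)" and w: "f x \<in> {1..M}" using x parity f_range by auto
  have "f x - 1 \<in> {1..M}" "f x + 1 \<in> {1..M}" "2 \<le> f x" using even_bounds[OF w ev] by auto
  then obtain l r where lr: "l \<in> {1..M}" "r \<in> {1..M}" and l: "f l = f x - 1" and fr: "f r = f x + 1"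
    using f_pos pos_range by metis
  have fl: "f x = f l + 1" using l \<open>2 \<le> f x\<close> by linarith
  have od: "odd (f l)" using ev fl by simp
  have fr': "f r = f l + 2" using fl fr by linarith
  have ne: "l \<noteq> x" "r \<noteq> x" "l \<noteq> r" using fl fr by auto
  have 1: "\<not> (l < r \<and> r < x \<or> x < r \<and> r < l)"
    using below[OF lr(1) x(1) lr(2) fl od] fr' by linarith
  have 2: "\<not> (x < l \<and> l < r \<or> r < l \<and> l < x)"
    using above[OF x(1) lr(2) lr(1) fr ev] fr' by linarith
  have 3: "l < r \<longleftrightarrow> \<not> 4 dvd f x"
    using rows[OF lr od fr'] fl od by presburger
  show thesis
  proof (rule that[OF lr fl fr od])
    show "if 4 dvd f x then r < x \<and> x < l else l < x \<and> x < r"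
      using 1 2 3 ne by (meson linorder_neqE_nat)
  qed
qed

text \<open>
  By the Baxter condition, the entries between \<open>l\<close> and \<open>x\<close> are smaller than \<open>f x\<close> and those between
  \<open>x\<close> and \<open>r\<close> are larger.  So the two neighbours of position \<open>x\<close> are in the same order as the
  positions \<open>l\<close> and \<open>r\<close>, and comparing the alternation of entries with that of positions gives the
  claim.  For the permutation induced on the even entries it says that parity is preserved.
\<close>

lemma even_entry_4_dvd:
  assumes x: "x \<in> {1..M}" "even x"
  shows "4 dvd f x \<longleftrightarrow> 4 dvd x"
proof -
  obtain l r where lr: "l \<in> {1..M}" "r \<in> {1..M}" and fl: "f x = f l + 1" and fr: "f r = f x + 1"
    and od: "odd (f l)" and cr: "if 4 dvd f x then r < x \<and> x < l else l < x \<and> x < r"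
    using crossing[OF x] by metis
  have ev: "even (f x)" using fl od by simp
  have x2: "2 \<le> x" "x + 1 \<le> M" using even_bounds[OF x] by auto
  then obtain p where p: "x = p + 1" "1 \<le> p" using le_Suc_ex[of 2 x] by auto
  have col: "f p < f (x + 1) \<longleftrightarrow> \<not> 4 dvd x"
    using columns[of p] x2 p x(2) by (simp, presburger)
  have nb: "p \<in> {1..M}" "x + 1 \<in> {1..M}" using x2 p by auto
  have lw: "f z < f x" if "z \<in> {1..M}" "l \<le> z \<and> z < x \<or> x < z \<and> z \<le> l" for z
    using below[OF lr(1) x(1) that(1) fl od] that(2) fl by (cases "z = l") auto
  have up: "f x < f z" if "z \<in> {1..M}" "r \<le> z \<and> z < x \<or> x < z \<and> z \<le> r" for z
    using above[OF x(1) lr(2) that(1) fr ev] that(2) fr by (cases "z = r") auto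
  show ?thesis
  proof (cases "4 dvd f x")
    case True
    then have "f (x + 1) < f x" "f x < f p"
      using cr lw[OF nb(2)] up[OF nb(1)] p(1) by auto
    then show ?thesis using col True by linarith
  next
    case False
    then have "f p < f x" "f x < f (x + 1)"
      using cr lw[OF nb(1)] up[OF nb(2)] p(1) by auto
    then show ?thesis using col False by linarith
  qed
qed

lemma first_4_dvd: "4 dvd f 1 + 3"
proof -
  have "f 1 < f (1 + 2)" using columns[of 1] M_ge_3 by simp
  then have "f 1 < f 3" by (simp del: One_nat_def)
  moreover have fr: "f 1 \<in> {1..M}" "f 3 \<in> {1..M}" using f_range M_ge_3 by auto
  moreover have od: "odd (f 1)" "odd (f 3)" using parity[of 1] parity[of 3] M_ge_3 by auto
  ultimately have "f 1 + 2 \<le> f 3" by presburger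
  then have r: "f 1 + 2 \<in> {1..M}" using fr by auto
  have "pos (f 1 + 2) \<noteq> 1" using f_pos[OF r] by auto
  then show ?thesis
    using rows[of 1 "pos (f 1 + 2)"] f_pos[OF r] pos_range[OF r] od M_ge_3 by auto
qed

text \<open>
  Let \<open>K\<close> be the first entry, and cut at the position \<open>e\<close> of \<open>K - 1\<close>.  The Baxter condition for
  \<open>K - 1\<close> and \<open>K\<close> makes every entry before \<open>e\<close> at least \<open>K\<close>; the point is that no entry
  after \<open>e\<close> exceeds \<open>K\<close>.

  An even value \<open>w > K\<close> and the value \<open>w + 1\<close> lie on the same side of \<open>e\<close>, because everything between
  them exceeds \<open>w + 1\<close>.  Before \<open>e\<close> there is one more even position congruent to \<open>2\<close> modulo \<open>4\<close>
  than there are positive ones divisible by \<open>4\<close>, and even entries preserve these residues.  Hence to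
  the left of \<open>e\<close> the odd values congruent to \<open>3\<close> are at least as many as those congruent to \<open>1\<close>, the
  value \<open>K\<close> included.  Since the positions of odd values alternate, \<open>u\<close> congruent to \<open>1\<close> lies left of
  \<open>u + 2\<close>, so that \<open>v \<mapsto> v - 2\<close> maps the first kind injectively into the second, and by the count it is
  onto.  So if an odd value \<open>u\<close> is left of \<open>e\<close>, then so is \<open>u + 2\<close>: by surjectivity if \<open>u\<close> is congruent
  to \<open>1\<close>, and because \<open>u + 2\<close> precedes \<open>u\<close> if \<open>u\<close> is congruent to \<open>3\<close>.  Starting from \<open>K\<close>, all odd
  values from \<open>K\<close> on are left of \<open>e\<close>, and the even ones follow.
\<close>

lemma skew_cut:
  assumes "f 1 \<noteq> 1"
  defines "e \<equiv> pos (f 1 - 1)"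
  shows "4 dvd e" "e \<in> {1..M}" "\<And>x. x \<in> {1..M} \<Longrightarrow> x < e \<longleftrightarrow> f 1 \<le> f x"
proof -
  let ?K = "f 1"
  have one: "1 \<in> {1..M}" using M_ge_3 by auto
  have K: "?K \<in> {1..M}" "4 dvd ?K + 3" using f_range[OF one] first_4_dvd by auto
  then have K5: "?K \<ge> 5" using assms by presburger
  then have Km: "?K - 1 \<in> {1..M}" using K by auto
  have e: "e \<in> {1..M}" "?K = f e + 1" using f_pos[OF Km] pos_range[OF Km] K5 unfolding e_def by auto
  have eve: "even e" using parity[OF e(1)] e(2) K(2) K5 by presburger
  have e4: "4 dvd e" using even_entry_4_dvd[OF e(1) eve] e(2) K K5 by presburger
  have e1: "4 \<le> e" using e(1) e4 by (auto dest: dvd_imp_le)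
  have left: "?K \<le> f x" if "1 \<le> x" "x < e" for x
  proof (cases "x = 1")
    case False
    have "x \<in> {1..M}" "even (f e)" using that e(1) eve parity[OF e(1)] by auto
    then have "f 1 < f x" using above[OF e(1) one _ e(2)] that False by simp
    then show ?thesis by simp
  qed simp
  have step: "x < e \<longleftrightarrow> y < e"
    if "x \<in> {1..M}" "y \<in> {1..M}" "even x" "?K < f x" "f y = f x + 1" for x y
  proof -
    have "\<not> (x < e \<and> e < y \<or> y < e \<and> e < x)"
    proof
      assume h: "x < e \<and> e < y \<or> y < e \<and> e < x"
      have "even (f x)" using that(1,3) parity by simp
      from above[OF that(1,2) e(1) that(5) this h] show False using that(4,5) e(2) by linarith
    qed
    moreover have "x \<noteq> e" "y \<noteq> e" using that(4,5) e(2) by auto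
    ultimately show ?thesis by auto
  qed
  \<comment> \<open>\<open>E0\<close>, \<open>E2\<close>: even positions by residue; \<open>D1\<close>, \<open>D3\<close>: odd positions by the residue of their entry\<close>
  define E0 where "E0 = {x. 1 \<le> x \<and> x < e \<and> 4 dvd x}"
  define E2 where "E2 = {x. 1 \<le> x \<and> x < e \<and> even x \<and> \<not> 4 dvd x}"
  define D1 where "D1 = {x. 1 \<le> x \<and> x < e \<and> odd x \<and> 4 dvd f x + 3}"
  define D3 where "D3 = {x. 1 \<le> x \<and> x < e \<and> odd x \<and> \<not> 4 dvd f x + 3}"
  let ?s = "\<lambda>x. pos (f x + 1)"
  have fin: "finite E0" "finite E2" "finite D1" "finite D3"
    unfolding E0_def E2_def D1_def D3_def by auto
  have succ: "f x + 1 \<in> {1..M}" if "x \<in> {1..M}" "even x" for x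
    using f_range[OF that(1)] parity[OF that(1)] that(2) odd_M by (cases "f x = M") auto
  have D1: "D1 \<subseteq> insert 1 (?s ` E0)"
  proof
    fix y assume y: "y \<in> D1"
    then have yM: "y \<in> {1..M}" "y < e" "4 dvd f y + 3" using e unfolding D1_def by auto
    show "y \<in> insert 1 (?s ` E0)"
    proof (cases "y = 1")
      case False
      then have "f y \<noteq> ?K" using f_inj[OF yM(1) one] by simp
      moreover have "?K \<le> f y" using left[of y] yM by auto
      ultimately have gt: "?K < f y - 1" using yM(3) K(2) by presburger
      then have r: "f y - 1 \<in> {1..M}" using f_range[OF yM(1)] by auto
      define x where "x = pos (f y - 1)"
      have x: "x \<in> {1..M}" "f y = f x + 1" using f_pos[OF r] pos_range[OF r] gt unfolding x_def by simp_all
      have evx: "even x" using parity[OF x(1)] x(2) yM(3) gt by presburger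
      have "4 dvd x" using even_entry_4_dvd[OF x(1) evx] x(2) yM(3) gt by presburger
      moreover have "x < e" using step[OF x(1) yM(1) evx _ x(2)] yM(2) gt x(2) by simp
      ultimately have "x \<in> E0" using x unfolding E0_def by auto
      moreover have "y = ?s x" using pos_f[OF yM(1)] x(2) by simp
      ultimately show ?thesis by blast
    qed simp
  qed
  have E2_M: "x \<in> {1..M}" "x < e" "even x" "\<not> 4 dvd x" if "x \<in> E2" for x
    using that e unfolding E2_def by auto
  have D3: "?s ` E2 \<subseteq> D3"
  proof (rule image_subsetI)
    fix x assume "x \<in> E2"
    note x = E2_M[OF this]
    note r = succ[OF x(1,3)]
    have "?K \<le> f x" using left[of x] x by auto
    then have gt: "?K < f x" using parity[OF x(1)] x(3) K(2) by presburger
    have "?s x < e" using step[OF x(1) pos_range[OF r] x(3) gt f_pos[OF r]] x(2) by simp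
    moreover have "odd (?s x)" using parity[OF pos_range[OF r]] f_pos[OF r] parity[OF x(1)] x(3) by simp
    moreover have "\<not> 4 dvd f x + 1 + 3" using even_entry_4_dvd[OF x(1,3)] x(4) by presburger
    moreover have "1 \<le> ?s x" using pos_range[OF r] by (meson atLeastAtMost_iff)
    ultimately show "?s x \<in> D3"
      unfolding D3_def mem_Collect_eq f_pos[OF r] by blast
  qed
  have inj: "inj_on ?s E2"
  proof (rule inj_onI)
    fix x y assume x: "x \<in> E2" and y: "y \<in> E2" and eq: "?s x = ?s y"
    have "f x + 1 = f y + 1"
      using f_pos[OF succ[OF E2_M(1,3)[OF x]]] f_pos[OF succ[OF E2_M(1,3)[OF y]]] eq by metis
    then show "x = y" using f_inj E2_M(1) x y by simp
  qed
  have E2: "(\<lambda>x. x + 2) ` insert 0 E0 \<subseteq> E2"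
  proof (rule image_subsetI)
    fix x assume "x \<in> insert 0 E0"
    then have "4 dvd x" "x < e" using e1 unfolding E0_def by auto
    then have "x + 2 < e \<and> even (x + 2) \<and> \<not> 4 dvd x + 2" using e4 by presburger
    then show "x + 2 \<in> E2" unfolding E2_def by simp
  qed
  \<comment> \<open>the shift \<open>x \<mapsto> x + 2\<close> on \<open>insert 0 E0\<close> supplies the position that makes up for \<open>1 \<in> D1\<close>\<close>
  have "card D1 \<le> card (insert 1 (?s ` E0))" using D1 fin by (intro card_mono) auto
  also have "\<dots> \<le> Suc (card (?s ` E0))" using fin by (simp add: card_insert_if)
  also have "\<dots> \<le> Suc (card E0)" using card_image_le[OF fin(1), of ?s] by simp
  also have "\<dots> = card (insert 0 E0)" using fin unfolding E0_def by auto
  also have "\<dots> = card ((\<lambda>x. x + 2) ` insert 0 E0)" by (subst card_image) (auto simp: inj_on_def)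
  also have "\<dots> \<le> card E2" using E2 fin by (intro card_mono) auto
  also have "\<dots> = card (?s ` E2)" using inj by (simp add: card_image)
  also have "\<dots> \<le> card D3" using D3 fin by (intro card_mono) auto
  finally have le: "card D1 \<le> card D3" .
  let ?t = "\<lambda>x. pos (f x - 2)"
  have D3_M: "x \<in> {1..M}" "x < e" "odd (f x)" "\<not> 4 dvd f x + 3" "?K \<le> f x" if "x \<in> D3" for x
    using that e left[of x] parity[of x] unfolding D3_def by auto
  have pred: "f x - 2 \<in> {1..M}" "?K \<le> f x - 2" "2 \<le> f x" if "x \<in> D3" for x
  proof -
    note x = D3_M[OF that]
    show "?K \<le> f x - 2" using x(3,4,5) K(2) by presburger
    then show "f x - 2 \<in> {1..M}" "2 \<le> f x" using f_range[OF x(1)] K5 by auto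
  qed
  have t_sub: "?t ` D3 \<subseteq> D1"
  proof (rule image_subsetI)
    fix x assume x: "x \<in> D3"
    note xs = D3_M[OF x] note p = pred[OF x]
    have m: "4 dvd f (?t x) + 3" "odd (f (?t x))"
      using xs(3,4) p(3) unfolding f_pos[OF p(1)] by presburger+
    have "f x = f (?t x) + 2" using f_pos[OF p(1)] p(3) by simp
    then have "?t x < x" using rows[OF pos_range[OF p(1)] xs(1) m(2)] m(1) by simp
    then show "?t x \<in> D1"
      using xs(2) pos_range[OF p(1)] m parity[OF pos_range[OF p(1)]] unfolding D1_def by simp
  qed
  have t_inj: "inj_on ?t D3"
  proof (rule inj_onI)
    fix x y assume x: "x \<in> D3" and y: "y \<in> D3" and eq: "?t x = ?t y"
    then have "f x - 2 = f y - 2" using f_pos pred(1) by metis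
    then have "f x = f y" using pred(3)[OF x] pred(3)[OF y] by simp
    then show "x = y" using f_inj D3_M(1) x y by blast
  qed
  have t_img: "?t ` D3 = D1"
    using le t_sub fin by (intro card_seteq) (auto simp: card_image[OF t_inj])
  have up: "u \<in> {1..M} \<Longrightarrow> odd u \<Longrightarrow> ?K \<le> u \<Longrightarrow> pos u < e" for u
  proof (induction u rule: less_induct)
    case (less u)
    show ?case
    proof (cases "u = ?K")
      case True then show ?thesis using pos_f[OF one] e1 by simp
    next
      case False
      have "?K \<le> u - 2 \<and> odd (u - 2)" using less.prems(2,3) False K(2) K5 by presburger
      then have u2: "?K \<le> u - 2" "odd (u - 2)" by auto
      then have r: "u - 2 \<in> {1..M}" using less.prems K5 by auto
      have IH: "pos (u - 2) < e" using less.IH[of "u - 2"] r less.prems K5 u2 by auto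
      note gu = f_pos[OF r] pos_range[OF r] f_pos[OF less.prems(1)] pos_range[OF less.prems(1)]
      show ?thesis
      proof (cases "4 dvd (u - 2) + 3")
        case True
        then have "pos (u - 2) \<in> D1" using IH gu(1,2) u2 parity[OF gu(2)] unfolding D1_def by simp
        then obtain x where x: "x \<in> D3" "pos (u - 2) = ?t x" using t_img by auto
        then have "u - 2 = f x - 2" using gu(1) f_pos[OF pred(1)] by metis
        then have "f x = u" using pred(3)[OF x(1)] u2 K5 by simp
        then show ?thesis using x D3_M[of x] pos_f by auto
      next
        case False
        moreover have "f (pos u) = f (pos (u - 2)) + 2" using gu(1,3) u2 K5 by simp
        ultimately have "\<not> pos (u - 2) < pos u"
          using rows[OF gu(2,4)] gu(1) u2 by simp
        then show ?thesis using IH by simp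
      qed
    qed
  qed
  have right: "x < e" if "x \<in> {1..M}" "?K \<le> f x" for x
  proof (cases "odd x")
    case True
    then show ?thesis using up[of "f x"] that f_range parity pos_f by auto
  next
    case False
    note r = succ[OF that(1)]
    have "?K < f x" using that(2) parity[OF that(1)] False K(2) by presburger
    moreover have "pos (f x + 1) < e"
      using up[of "f x + 1"] that(2) parity[OF that(1)] False r by simp
    ultimately show ?thesis using step[OF that(1) pos_range[OF r]] f_pos[OF r] False by simp
  qed
  show "4 dvd e" "e \<in> {1..M}" by fact+
  show "x < e \<longleftrightarrow> ?K \<le> f x" if "x \<in> {1..M}" for x using left right that by auto
qed

end

section \<open>Skew sums and framed complements\<close>

lemma bij_betw_endoI:
  assumes "\<And>x. x \<in> {1..M} \<Longrightarrow> f x \<in> {1..M}" "inj_on f {1..M}"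
  shows "bij_betw f {1..M} {1..M::nat}"
  using assms endo_inj_surj[of "{1..M}" f] by (simp add: bij_betw_def image_subset_iff)

lemma alternating_baxter_3: "alternating_baxter 3 (\<lambda>x. x)"
proof
  show "bij_betw (\<lambda>x. x) {1..3::nat} {1..3}" by (auto simp: bij_betw_def)
  show "x < x + 2 \<longleftrightarrow> 4 dvd x + 3" if "odd x" "x + 2 \<le> 3" for x :: nat
  proof -
    have "x = 1" using that by presburger
    then show ?thesis by simp
  qed
  show "x < y \<longleftrightarrow> 4 dvd x + 3" if "x \<in> {1..3}" "y \<in> {1..3}" "odd x" "y = x + 2" for x y :: nat
  proof -
    have "x = 1" using that by auto
    then show ?thesis using that by simp
  qed
qed auto

text \<open>
  The entries of \<open>h \<ominus> 1 \<ominus> q\<close> for \<open>h\<close> of length \<open>a\<close> and \<open>q\<close> of length \<open>b\<close>.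
\<close>

definition skew_glue :: "nat \<Rightarrow> (nat \<Rightarrow> nat) \<Rightarrow> nat \<Rightarrow> (nat \<Rightarrow> nat) \<Rightarrow> nat \<Rightarrow> nat" where
  "skew_glue a h b q x =
     (if x \<le> a then h x + (b + 1) else if x = a + 1 then b + 1 else q (x - (a + 1)))"

text \<open>
  The entries of \<open>1 \<oplus> 1 \<oplus> c(q) \<oplus> 1 \<oplus> 1\<close> for \<open>q\<close> of length \<open>b\<close>.
\<close>

definition framed_complement :: "nat \<Rightarrow> (nat \<Rightarrow> nat) \<Rightarrow> nat \<Rightarrow> nat" where
  "framed_complement b q x = (if x \<le> 2 \<or> b + 3 \<le> x then x else b + 3 - q (x - 2))"

text \<open>
  Both \<open>a + 1\<close> and \<open>b + 1\<close> are divisible by \<open>4\<close>, so the two blocks are shifted without changing any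
  residue.  Only pairs of values or positions that straddle the middle entry \<open>b + 1\<close> need an argument:
  it separates the maximum of \<open>q\<close> from the minimum of \<open>h\<close>, and across it both entries and positions descend.
\<close>

lemma alternating_baxter_skew_glue:
  assumes "alternating_baxter a h" "alternating_baxter b q"
  shows "alternating_baxter (a + b + 1) (skew_glue a h b q)"
proof -
  interpret h: alternating_baxter a h by fact
  interpret q: alternating_baxter b q by fact
  let ?M = "a + b + 1" and ?p = "skew_glue a h b q"
  have pos: "(\<exists>x' \<in> {1..a}. x = x') \<or> x = a + 1 \<or> (\<exists>x' \<in> {1..b}. x = x' + (a + 1))" if "x \<in> {1..?M}" for x
  proof -
    have "x - (a + 1) \<in> {1..b} \<and> x = (x - (a + 1)) + (a + 1)" if "\<not> x \<le> a" "x \<noteq> a + 1"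
      using that \<open>x \<in> {1..?M}\<close> by auto
    then show ?thesis using that by (metis atLeastAtMost_iff)
  qed
  have p1: "?p x = h x + (b + 1)" if "x \<in> {1..a}" for x using that by (simp add: skew_glue_def)
  have p2: "?p (a + 1) = b + 1" by (simp add: skew_glue_def)
  have p3: "?p (x + (a + 1)) = q x" if "x \<in> {1..b}" for x using that by (simp add: skew_glue_def)
  have hr: "1 \<le> h x" "h x \<le> a" if "x \<in> {1..a}" for x using h.f_range[OF that] by auto
  have qr: "1 \<le> q x" "q x \<le> b" if "x \<in> {1..b}" for x using q.f_range[OF that] by auto
  have ev: "even (b + 1)" "even (a + 1)" using h.odd_M q.odd_M by auto
  have cases: "x \<in> {1..a} \<and> ?p x = h x + (b + 1) \<and> b + 2 \<le> ?p x \<and> ?p x \<le> ?M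
      \<or> x = a + 1 \<and> ?p x = b + 1
      \<or> (\<exists>x'. x' \<in> {1..b} \<and> x = x' + (a + 1) \<and> ?p x = q x' \<and> 1 \<le> ?p x \<and> ?p x \<le> b)"
    if x: "x \<in> {1..?M}" for x
  proof -
    have "b + 2 \<le> ?p x \<and> ?p x \<le> ?M" if "x \<in> {1..a}" using p1[OF that] hr[OF that] by simp
    moreover have "1 \<le> ?p x \<and> ?p x \<le> b" if "x' \<in> {1..b}" "x = x' + (a + 1)" for x'
      using p3[OF that(1)] qr[OF that(1)] that(2) by simp
    ultimately show ?thesis using pos[OF x] p1 p2 p3 by blast
  qed
  show ?thesis
  proof
    show "4 dvd ?M + 1" using h.len q.len by presburger
    show "bij_betw ?p {1..?M} {1..?M}"
    proof (rule bij_betw_endoI)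
      show "?p x \<in> {1..?M}" if "x \<in> {1..?M}" for x
        using cases[OF that] by auto
      show "inj_on ?p {1..?M}"
      proof (rule inj_onI)
        fix x y assume "x \<in> {1..?M}" "y \<in> {1..?M}" and eq: "?p x = ?p y"
        from cases[OF this(1)] cases[OF this(2)] show "x = y"
          using eq h.f_inj[of x y] q.f_inj by (elim disjE exE conjE) simp_all
      qed
    qed
    show "even (?p x) \<longleftrightarrow> even x" if "x \<in> {1..?M}" for x
      using pos[OF that]
    proof (elim disjE bexE)
      fix x' assume "x' \<in> {1..a}" "x = x'"
      then show ?thesis using p1 h.parity[of x'] ev by simp
    next
      assume "x = a + 1" then show ?thesis using p2 ev by simp
    next
      fix x' assume "x' \<in> {1..b}" "x = x' + (a + 1)"
      then show ?thesis using p3[of x'] q.parity[of x'] ev by simp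
    qed
    show "?p z < ?p x" if xyz: "x \<in> {1..?M}" "y \<in> {1..?M}" "z \<in> {1..?M}" and s: "?p y = ?p x + 1" and od: "odd (?p x)"
      and bt: "x < z \<and> z < y \<or> y < z \<and> z < x" for x y z
      using pos[OF xyz(1)]
    proof (elim disjE bexE)
      fix x' assume "x' \<in> {1..a}" "x = x'"
      then have x: "x \<in> {1..a}" by simp
      have y: "y \<in> {1..a}"
        using cases[OF xyz(2)] s p1[OF x] by auto
      then have z: "z \<in> {1..a}" using bt x by auto
      show ?thesis using h.below[OF x y z _ _ bt] s od p1[OF x] p1[OF y] p1[OF z] ev by simp
    next
      assume "x = a + 1" then show ?thesis using od p2 ev by simp
    next
      fix x' assume x: "x' \<in> {1..b}" "x = x' + (a + 1)"
      have y: "y = a + 1 \<or> (\<exists>y' \<in> {1..b}. y = y' + (a + 1))"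
        using cases[OF xyz(2)] s p3[OF x(1)] qr[OF x(1)] x(2) by auto
      then obtain z' where z: "z' \<in> {1..b}" "z = z' + (a + 1)" using pos[OF xyz(3)] bt x(2) by auto
      from y show ?thesis
      proof (elim disjE bexE)
        assume "y = a + 1"
        then have "q x' = b" using s p2 p3[OF x(1)] x(2) by simp
        moreover have "q z' \<noteq> q x'" using q.f_inj[OF x(1) z(1)] bt z(2) x(2) by auto
        ultimately show ?thesis using p3[OF x(1)] p3[OF z(1)] z(2) x(2) qr[OF z(1)] by simp
      next
        fix y' assume y: "y' \<in> {1..b}" "y = y' + (a + 1)"
        show ?thesis
          using q.below[OF x(1) y(1) z(1)] s od bt p3[OF x(1)] p3[OF y(1)] p3[OF z(1)] x(2) y(2) z(2) by simp
      qed
    qed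
    show "?p y < ?p z" if xyz: "x \<in> {1..?M}" "y \<in> {1..?M}" "z \<in> {1..?M}" and s: "?p y = ?p x + 1" and od: "even (?p x)"
      and bt: "x < z \<and> z < y \<or> y < z \<and> z < x" for x y z
      using pos[OF xyz(1)]
    proof (elim disjE bexE)
      fix x' assume "x' \<in> {1..a}" "x = x'"
      then have x: "x \<in> {1..a}" by simp
      have y: "y \<in> {1..a}"
        using cases[OF xyz(2)] s p1[OF x] by auto
      then have z: "z \<in> {1..a}" using bt x by auto
      show ?thesis using h.above[OF x y z _ _ bt] s od p1[OF x] p1[OF y] p1[OF z] ev by simp
    next
      assume x: "x = a + 1"
      have y: "y \<in> {1..a}"
        using cases[OF xyz(2)] s p2 x by auto
      then have z: "z \<in> {1..a}" using bt x by auto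
      have "h y = 1" using s p2 p1[OF y] x by simp
      moreover have "h z \<noteq> h y" using h.f_inj[OF z y] bt by auto
      ultimately show ?thesis using p1[OF y] p1[OF z] hr[OF z] by simp
    next
      fix x' assume x: "x' \<in> {1..b}" "x = x' + (a + 1)"
      have "y = a + 1 \<or> (\<exists>y' \<in> {1..b}. y = y' + (a + 1))"
        using cases[OF xyz(2)] s p3[OF x(1)] qr[OF x(1)] x(2) by auto
      moreover have "y \<noteq> a + 1" using s p2 p3[OF x(1)] x(2) od ev(1) by auto
      ultimately obtain y' where y: "y' \<in> {1..b}" "y = y' + (a + 1)" by auto
      then obtain z' where z: "z' \<in> {1..b}" "z = z' + (a + 1)" using pos[OF xyz(3)] bt x(2) by auto
      show ?thesis
        using q.above[OF x(1) y(1) z(1)] s od bt p3[OF x(1)] p3[OF y(1)] p3[OF z(1)] x(2) y(2) z(2) by simp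
    qed
    show "?p x < ?p (x + 2) \<longleftrightarrow> 4 dvd x + 3" if od: "odd x" and le: "x + 2 \<le> ?M" for x
    proof -
      have "x \<in> {1..?M}" using od le by (cases x) auto
      from pos[OF this] show ?thesis
      proof (elim disjE bexE)
        fix x' assume "x' \<in> {1..a}" "x = x'"
        then have x: "x \<in> {1..a}" by simp
        show ?thesis
        proof (cases "x + 2 \<le> a")
          case True
          then show ?thesis using h.columns[OF od] p1[of x] p1[of "x + 2"] x by simp
        next
          case False
          then have xa: "x = a" using x od h.odd_M unfolding atLeastAtMost_iff by presburger
          have "1 \<in> {1..b}" using q.M_ge_3 by auto
          from p3[OF this] qr[OF this] have "?p (x + 2) \<le> b" using xa by simp
          moreover have "b < ?p x" using p1[OF x] by simp
          moreover have "\<not> 4 dvd x + 3" using xa h.len by presburger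
          ultimately show ?thesis by linarith
        qed
      next
        assume "x = a + 1" then show ?thesis using od ev by simp
      next
        fix x' assume x: "x' \<in> {1..b}" "x = x' + (a + 1)"
        have od': "odd x'" "x' + 2 \<le> b" using x od le ev(2) by auto
        have "?p (x + 2) = q (x' + 2)" using p3[of "x' + 2"] od' x by (simp add: add.commute add.left_commute)
        moreover have "4 dvd x' + 3 \<longleftrightarrow> 4 dvd x + 3" using x(2) h.len by presburger
        ultimately show ?thesis using q.columns[OF od'] p3[OF x(1)] x(2) by simp
      qed
    qed
    show "x < y \<longleftrightarrow> 4 dvd ?p x + 3" if xy: "x \<in> {1..?M}" "y \<in> {1..?M}" and od: "odd (?p x)" and s: "?p y = ?p x + 2" for x y
      using pos[OF xy(1)]
    proof (elim disjE bexE)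
      fix x' assume "x' \<in> {1..a}" "x = x'"
      then have x: "x \<in> {1..a}" by simp
      have y: "y \<in> {1..a}"
        using cases[OF xy(2)] s p1[OF x] by auto
      have "4 dvd ?p x + 3 \<longleftrightarrow> 4 dvd h x + 3" using p1[OF x] q.len by presburger
      then show ?thesis using h.rows[OF x y] s od p1[OF x] p1[OF y] ev by simp
    next
      assume "x = a + 1" then show ?thesis using od p2 ev by simp
    next
      fix x' assume x: "x' \<in> {1..b}" "x = x' + (a + 1)"
      have px: "?p x = q x'" using p3[OF x(1)] x(2) by simp
      from pos[OF xy(2)] show ?thesis
      proof (elim disjE bexE)
        fix y' assume y: "y' \<in> {1..a}" "y = y'"
        then have "q x' = b" using s px p1[OF y(1)] hr[OF y(1)] qr[OF x(1)] od q.odd_M by presburger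
        moreover have "\<not> 4 dvd b + 3" using q.len by presburger
        ultimately show ?thesis using px x y by simp
      next
        assume "y = a + 1"
        moreover have "odd (?p y)" using s od by simp
        ultimately show ?thesis using p2 ev by simp
      next
        fix y' assume y: "y' \<in> {1..b}" "y = y' + (a + 1)"
        show ?thesis using q.rows[OF x(1) y(1)] s od px p3[OF y(1)] y(2) x(2) by simp
      qed
    qed
  qed
qed

text \<open>
  Complementing exchanges the two halves of the Baxter condition and reverses ascents and descents of
  the odd entries.  The shift by two positions and by two values turns the resulting pattern back into
  one that begins with an ascent, and the two added pairs provide the first and the last ascent.
\<close>

lemma alternating_baxter_framed_complement:
  assumes "alternating_baxter b q"
  shows "alternating_baxter (b + 4) (framed_complement b q)"
proof -
  interpret q: alternating_baxter b q by fact
  let ?M = "b + 4"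
  define p where "p = framed_complement b q"
  have ev: "odd b" by (fact q.odd_M)
  have qr: "1 \<le> q x" "q x \<le> b" if "x \<in> {1..b}" for x using q.f_range[OF that] by auto
  have p_ends: "p 1 = 1" "p 2 = 2" "p (b + 3) = b + 3" "p (b + 4) = b + 4"
    by (simp_all add: p_def framed_complement_def)
  have p_mid: "p (x + 2) + q x = b + 3" if "x \<in> {1..b}" for x
    using that qr[OF that] by (simp add: p_def framed_complement_def)
  have cases: "x = 1 \<and> p x = 1 \<or> x = 2 \<and> p x = 2
      \<or> (\<exists>x'. x' \<in> {1..b} \<and> x = x' + 2 \<and> p x + q x' = b + 3 \<and> 3 \<le> p x \<and> p x \<le> b + 2)
      \<or> x = b + 3 \<and> p x = b + 3 \<or> x = b + 4 \<and> p x = b + 4"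
    if x: "x \<in> {1..?M}" for x
  proof -
    consider "x = 1" | "x = 2" | "x - 2 \<in> {1..b}" "x = (x - 2) + 2" | "x = b + 3" | "x = b + 4"
      using x by force
    then show ?thesis
    proof cases
      case 3
      then have "3 \<le> p x \<and> p x \<le> b + 2" "p x + q (x - 2) = b + 3"
        using p_mid[OF 3(1)] qr[OF 3(1)] by auto
      then show ?thesis using 3 by blast
    qed (use p_ends in simp_all)
  qed
  have inj: "inj_on p {1..?M}"
  proof (rule inj_onI)
    fix x y assume xy: "x \<in> {1..?M}" "y \<in> {1..?M}" and eq: "p x = p y"
    show "x = y"
    proof (cases "3 \<le> p x \<and> p x \<le> b + 2")
      case True
      then obtain x' y' where "x' \<in> {1..b}" "x = x' + 2" "p x + q x' = b + 3"
        "y' \<in> {1..b}" "y = y' + 2" "p y + q y' = b + 3"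
        using cases[OF xy(1)] cases[OF xy(2)] eq by auto
      then show ?thesis using q.f_inj[of x' y'] eq by simp
    next
      case False
      then show ?thesis using cases[OF xy(1)] cases[OF xy(2)] eq by (elim disjE exE conjE; linarith)
    qed
  qed
  show ?thesis unfolding p_def[symmetric]
  proof
    show "4 dvd ?M + 1" using q.len by presburger
    show "bij_betw p {1..?M} {1..?M}"
    proof (rule bij_betw_endoI)
      show "p x \<in> {1..?M}" if "x \<in> {1..?M}" for x
        using cases[OF that] by auto
    qed (fact inj)
    show "even (p x) \<longleftrightarrow> even x" if "x \<in> {1..?M}" for x
      using cases[OF that]
    proof (elim disjE exE conjE)
      fix x' assume x: "x' \<in> {1..b}" "x = x' + 2" "p x + q x' = b + 3"
      have "even (p x + q x')" unfolding x(3) using ev by simp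
      then have "even (p x) \<longleftrightarrow> even (q x')" by simp
      then show ?thesis using q.parity[OF x(1)] x(2) by simp
    qed (use ev in simp_all)
    show "p z < p x" if xyz: "x \<in> {1..?M}" "y \<in> {1..?M}" "z \<in> {1..?M}" and s: "p y = p x + 1" and od: "odd (p x)"
      and bt: "x < z \<and> z < y \<or> y < z \<and> z < x" for x y z
      using cases[OF xyz(1)]
    proof (elim disjE exE conjE)
      assume "x = 1" "p x = 1"
      then have "y = 2" using cases[OF xyz(2)] s by auto
      then show ?thesis using bt \<open>x = 1\<close> by auto
    next
      assume "x = b + 3" "p x = b + 3" then show ?thesis using od ev by simp
    next
      assume "x = b + 4" "p x = b + 4" then show ?thesis using s cases[OF xyz(2)] by auto
    next
      fix x' assume x: "x' \<in> {1..b}" "x = x' + 2" "p x + q x' = b + 3" "3 \<le> p x" "p x \<le> b + 2"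
      have y: "y = b + 3 \<and> p y = b + 3 \<or> (\<exists>y'. y' \<in> {1..b} \<and> y = y' + 2 \<and> p y + q y' = b + 3)"
        using cases[OF xyz(2)] s x(4,5) by auto
      then obtain z' where z: "z' \<in> {1..b}" "z = z' + 2" "p z + q z' = b + 3" "p z \<le> b + 2"
        using cases[OF xyz(3)] bt x(1,2) by auto
      from y show ?thesis
      proof (elim disjE exE conjE)
        assume "y = b + 3" "p y = b + 3"
        then have "p x = b + 2" using s by simp
        moreover have "q z' \<noteq> q x'" using q.f_inj[OF x(1) z(1)] bt z(2) x(2) by auto
        ultimately show ?thesis using x(3) z(3,4) by linarith
      next
        fix y' assume y: "y' \<in> {1..b}" "y = y' + 2" "p y + q y' = b + 3"
        have "q x' = q y' + 1" using s x(3) y(3) by linarith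
        moreover have "even (q y')" using y(3) od s ev by presburger
        ultimately have "q x' < q z'" using q.above[OF y(1) x(1) z(1)] bt x(2) y(2) z(2) by auto
        then show ?thesis using x(3) z(3) by linarith
      qed
    qed (use od in simp)
    show "p y < p z" if xyz: "x \<in> {1..?M}" "y \<in> {1..?M}" "z \<in> {1..?M}" and s: "p y = p x + 1" and od: "even (p x)"
      and bt: "x < z \<and> z < y \<or> y < z \<and> z < x" for x y z
      using cases[OF xyz(1)]
    proof (elim disjE exE conjE)
      assume x: "x = 2" "p x = 2"
      have y: "y \<le> b + 2" using cases[OF xyz(2)] s x q.M_ge_3 by auto
      then have "3 \<le> p z" using bt x xyz(2) cases[OF xyz(3)] by auto
      moreover have "p z \<noteq> 3"
      proof
        assume "p z = 3"
        then have "p y = p z" using s x by simp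
        then have "y = z" using inj xyz(2,3) by (simp add: inj_on_eq_iff)
        then show False using bt by simp
      qed
      ultimately show ?thesis using s x by linarith
    next
      assume x: "x = b + 3" "p x = b + 3"
      then have "y = b + 4" using cases[OF xyz(2)] s by auto
      then show ?thesis using bt x by auto
    next
      assume "x = b + 4" "p x = b + 4" then show ?thesis using s cases[OF xyz(2)] by auto
    next
      fix x' assume x: "x' \<in> {1..b}" "x = x' + 2" "p x + q x' = b + 3" "3 \<le> p x" "p x \<le> b + 2"
      have "p x \<noteq> b + 2" using od ev by auto
      then obtain y' where y: "y' \<in> {1..b}" "y = y' + 2" "p y + q y' = b + 3"
        using cases[OF xyz(2)] s x(4,5) by auto
      then obtain z' where z: "z' \<in> {1..b}" "z = z' + 2" "p z + q z' = b + 3"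
        using cases[OF xyz(3)] bt x(1,2) by auto
      have "q x' = q y' + 1" using s x(3) y(3) by linarith
      moreover have "odd (q y')" using y(3) od s ev by presburger
      ultimately have "q z' < q y'" using q.below[OF y(1) x(1) z(1)] bt x(2) y(2) z(2) by auto
      then show ?thesis using y(3) z(3) by linarith
    qed (use od in simp)
    show "p x < p (x + 2) \<longleftrightarrow> 4 dvd x + 3" if od: "odd x" and le: "x + 2 \<le> ?M" for x
    proof -
      have x1: "x \<in> {1..?M}" "x + 2 \<in> {1..?M}" using od le by (cases x; auto)+
      from cases[OF x1(1)] show ?thesis
      proof (elim disjE exE conjE)
        assume x: "x = 1" "p x = 1"
        have "3 \<le> p (x + 2)" using cases[OF x1(2)] x q.M_ge_3 by auto
        then show ?thesis using x by simp
      next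
        assume "x = b + 3" then show ?thesis using od ev by simp
      next
        assume "x = b + 4" then show ?thesis using le by simp
      next
        fix x' assume x: "x' \<in> {1..b}" "x = x' + 2" "p x + q x' = b + 3" "p x \<le> b + 2"
        show ?thesis
        proof (cases "x' = b")
          case True
          then have "x = b + 2" using x(2) by simp
          then have "x + 2 = b + 4" "4 dvd x + 3" using q.len by (simp, presburger)
          moreover from this have "p (x + 2) = b + 4" using p_ends(4) by metis
          ultimately show ?thesis using x(4) by linarith
        next
          case False
          then have od': "odd x'" "x' + 2 \<le> b" "x' + 2 \<in> {1..b}"
            using x(1,2) od ev unfolding atLeastAtMost_iff by presburger+
          have "p (x + 2) + q (x' + 2) = b + 3" using p_mid[OF od'(3)] x(2) by simp
          moreover have "q x' \<noteq> q (x' + 2)" using q.f_inj[OF x(1) od'(3)] by simp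
          moreover have "4 dvd x + 3 \<longleftrightarrow> \<not> 4 dvd x' + 3" using x(2) od by presburger
          ultimately show ?thesis using q.columns[OF od'(1,2)] x(3) by linarith
        qed
      qed (use od in simp)
    qed
    show "x < y \<longleftrightarrow> 4 dvd p x + 3" if xy: "x \<in> {1..?M}" "y \<in> {1..?M}" and od: "odd (p x)" and s: "p y = p x + 2" for x y
      using cases[OF xy(1)]
    proof (elim disjE exE conjE)
      assume x: "x = 1" "p x = 1"
      then have "1 < y" using cases[OF xy(2)] s by auto
      then show ?thesis using x by simp
    next
      assume "x = b + 3" "p x = b + 3" then show ?thesis using od ev by simp
    next
      assume "x = b + 4" "p x = b + 4" then show ?thesis using s cases[OF xy(2)] by auto
    next
      fix x' assume x: "x' \<in> {1..b}" "x = x' + 2" "p x + q x' = b + 3" "3 \<le> p x" "p x \<le> b + 2"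
      have "y \<noteq> b + 3" using p_ends(3) od s ev by auto
      then have "y = b + 4 \<and> p y = b + 4 \<or> (\<exists>y'. y' \<in> {1..b} \<and> y = y' + 2 \<and> p y + q y' = b + 3)"
        using cases[OF xy(2)] s x(4,5) by auto
      then show ?thesis
      proof (elim disjE exE conjE)
        assume y: "y = b + 4" "p y = b + 4"
        then have "p x = b + 2" using s by simp
        then have "4 dvd p x + 3" using q.len by presburger
        then show ?thesis using x(1,2) y by simp
      next
        fix y' assume y: "y' \<in> {1..b}" "y = y' + 2" "p y + q y' = b + 3"
        have qq: "q x' = q y' + 2" "odd (q y')" using s x(3) y(3) ev od by presburger+
        then have "x' \<noteq> y'" by auto
        moreover have "4 dvd p x + 3 \<longleftrightarrow> \<not> 4 dvd q y' + 3" using qq x(3) q.len by presburger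
        ultimately show ?thesis using q.rows[OF y(1) x(1) qq(2,1)] x(2) y(2) by auto
      qed
    qed (use od in simp)
  qed
qed

section \<open>Decomposition of alternating complete Baxter permutations\<close>

context alternating_baxter
begin

text \<open>
  The length is congruent to \<open>3\<close> modulo \<open>4\<close>, so rotating the diagram by 180 degrees preserves every
  residue that matters.  This symmetry turns statements about the first entry into statements about the last.
\<close>

lemma reverse_complement: "alternating_baxter M (\<lambda>x. M + 1 - f (M + 1 - x))"
proof -
  let ?r = "\<lambda>x. M + 1 - x"
  let ?p = "\<lambda>x. M + 1 - f (?r x)"
  have r: "?r x \<in> {1..M}" if "x \<in> {1..M}" for x using that by auto
  have p: "?p x + f (?r x) = M + 1" if "x \<in> {1..M}" for x using f_range[OF r[OF that]] by simp
  have ev: "even (M + 1)" using odd_M by simp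
  show ?thesis
  proof
    show "4 dvd M + 1" by (fact len)
    show "bij_betw ?p {1..M} {1..M}"
    proof (rule bij_betw_endoI)
      show "?p x \<in> {1..M}" if "x \<in> {1..M}" for x using f_range[OF r[OF that]] by auto
      show "inj_on ?p {1..M}"
      proof (rule inj_onI)
        fix x y assume xy: "x \<in> {1..M}" "y \<in> {1..M}" "?p x = ?p y"
        then have "f (?r x) = f (?r y)" using p by (metis add_left_cancel)
        then show "x = y" using f_inj[OF r[OF xy(1)] r[OF xy(2)]] xy(1,2) by auto
      qed
    qed
    show "even (?p x) \<longleftrightarrow> even x" if "x \<in> {1..M}" for x
      using p[OF that] parity[OF r[OF that]] ev that by (metis add_diff_inverse_nat atLeastAtMost_iff even_add le_SucI Suc_eq_plus1 not_less)
    show "?p z < ?p x" if xyz: "x \<in> {1..M}" "y \<in> {1..M}" "z \<in> {1..M}" and s: "?p y = ?p x + 1" and od: "odd (?p x)"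
      and bt: "x < z \<and> z < y \<or> y < z \<and> z < x" for x y z
    proof -
      have "f (?r x) = f (?r y) + 1" using p[OF xyz(1)] p[OF xyz(2)] s by linarith
      moreover have "even (f (?r y))" using p[OF xyz(2)] od s ev by presburger
      moreover have "?r y < ?r z \<and> ?r z < ?r x \<or> ?r x < ?r z \<and> ?r z < ?r y" using bt xyz by auto
      ultimately have "f (?r x) < f (?r z)" by (rule above[OF r[OF xyz(2)] r[OF xyz(1)] r[OF xyz(3)]])
      then show ?thesis using p[OF xyz(1)] p[OF xyz(3)] by linarith
    qed
    show "?p y < ?p z" if xyz: "x \<in> {1..M}" "y \<in> {1..M}" "z \<in> {1..M}" and s: "?p y = ?p x + 1" and od: "even (?p x)"
      and bt: "x < z \<and> z < y \<or> y < z \<and> z < x" for x y z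
    proof -
      have "f (?r x) = f (?r y) + 1" using p[OF xyz(1)] p[OF xyz(2)] s by linarith
      moreover have "odd (f (?r y))" using p[OF xyz(2)] od s ev by presburger
      moreover have "?r y < ?r z \<and> ?r z < ?r x \<or> ?r x < ?r z \<and> ?r z < ?r y" using bt xyz by auto
      ultimately have "f (?r z) < f (?r y)" by (rule below[OF r[OF xyz(2)] r[OF xyz(1)] r[OF xyz(3)]])
      then show ?thesis using p[OF xyz(2)] p[OF xyz(3)] by linarith
    qed
    show "?p x < ?p (x + 2) \<longleftrightarrow> 4 dvd x + 3" if od: "odd x" and le: "x + 2 \<le> M" for x
    proof -
      have xM: "x \<in> {1..M}" "x + 2 \<in> {1..M}" using od le by (cases x; auto)+
      let ?u = "?r (x + 2)"
      have u: "odd ?u" "?u + 2 \<le> M" "?r x = ?u + 2" using od le odd_M xM(1) by auto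
      have "4 dvd x + 3 \<longleftrightarrow> 4 dvd ?u + 3" using len od le by presburger
      moreover have "?p x < ?p (x + 2) \<longleftrightarrow> f ?u < f (?r x)" using p[OF xM(1)] p[OF xM(2)] by linarith
      ultimately show ?thesis using columns[OF u(1,2)] u(3) by simp
    qed
    show "x < y \<longleftrightarrow> 4 dvd ?p x + 3" if xy: "x \<in> {1..M}" "y \<in> {1..M}" and od: "odd (?p x)" and s: "?p y = ?p x + 2" for x y
    proof -
      have "f (?r x) = f (?r y) + 2" "odd (f (?r y))"
        using p[OF xy(1)] p[OF xy(2)] s od ev by presburger+
      moreover have "4 dvd ?p x + 3 \<longleftrightarrow> 4 dvd f (?r y) + 3"
        using p[OF xy(1)] p[OF xy(2)] s od len by presburger
      moreover have "?r y < ?r x \<longleftrightarrow> x < y" using xy by auto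
      ultimately show ?thesis using rows[OF r[OF xy(2)] r[OF xy(1)]] by simp
    qed
  qed
qed


text \<open>
  Otherwise the rotated permutation does not begin with \<open>1\<close>, so it has a skew cut, before which its
  maximal entry must occur; but that entry, the image of \<open>f 1 = 1\<close>, is its last one.
\<close>

lemma starts_with_1_imp_ends_with_M:
  assumes "f 1 = 1"
  shows "f M = M"
proof (rule ccontr)
  let ?r = "\<lambda>x. M + 1 - f (M + 1 - x)"
  interpret r: alternating_baxter M ?r by (fact reverse_complement)
  have M: "M \<in> {1..M}" using M_ge_3 by simp
  assume "f M \<noteq> M"
  then have "?r 1 \<noteq> 1" using f_range[OF M] by auto
  from r.skew_cut[OF this] show False
    using M r.f_range[of 1] assms by fastforce
qed

lemma skew_decomposition:
  assumes "f 1 \<noteq> 1"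
  obtains a b h q where "M = a + b + 1" "alternating_baxter a h" "alternating_baxter b q" "h 1 = 1"
    "\<And>x. x \<in> {1..M} \<Longrightarrow> f x = skew_glue a h b q x"
proof -
  let ?e = "pos (f 1 - 1)"
  define a where "a = ?e - 1"
  define b where "b = M - ?e"
  note cut = skew_cut[OF assms]
  have e4: "4 \<le> ?e" using cut(1,2) by (auto dest: dvd_imp_le)
  have M: "M = a + b + 1" and ea: "?e = a + 1" using cut(2) e4 unfolding a_def b_def by auto
  have a4: "4 dvd a + 1" using cut(1) ea by simp
  have b4: "4 dvd b + 1" using a4 M len by presburger
  have one: "1 \<in> {1..M}" using M_ge_3 by simp
  have "bij_betw f {1..a} {f 1..M}"
  proof (intro bij_betw_imageI)
    show "inj_on f {1..a}" using bij M by (auto simp: bij_betw_def intro: inj_on_subset)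
    show "f ` {1..a} = {f 1..M}"
    proof
      show "f ` {1..a} \<subseteq> {f 1..M}"
      proof (rule image_subsetI)
        fix x assume x: "x \<in> {1..a}"
        then have "x \<in> {1..M}" using M by auto
        then show "f x \<in> {f 1..M}" using cut(3)[of x] f_range[of x] x ea by auto
      qed
      show "{f 1..M} \<subseteq> f ` {1..a}"
      proof
        fix v assume v: "v \<in> {f 1..M}"
        then have vM: "v \<in> {1..M}" using f_range[OF one] by auto
        then have "pos v \<in> {1..a}" using cut(3)[OF pos_range[OF vM]] f_pos[OF vM] v pos_range[OF vM] ea by auto
        then show "v \<in> f ` {1..a}" using f_pos[OF vM] by (metis imageI)
      qed
    qed
  qed
  \<comment> \<open>counting the entries before the cut determines the first one\<close>
  then have "a = M + 1 - f 1" using bij_betw_same_card by fastforce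
  then have f1: "f 1 = b + 2" using M f_range[OF one] e4 ea by auto
  define h where "h x = f x - (b + 1)" for x
  define q where "q x = f (x + (a + 1))" for x
  have h: "f x = h x + (b + 1)" "h x \<in> {1..a}" "x \<in> {1..M}" if "x \<in> {1..a}" for x
  proof -
    show x: "x \<in> {1..M}" using that M by simp
    have "b + 2 \<le> f x" "f x \<le> M" using cut(3)[OF x] that ea f1 f_range[OF x] by auto
    then show "f x = h x + (b + 1)" "h x \<in> {1..a}" using M unfolding h_def by auto
  qed
  have fe: "f (a + 1) = b + 1"
  proof -
    have "b + 1 \<in> {1..M}" using M by simp
    then show ?thesis using f_pos[of "b + 1"] f1 ea by simp
  qed
  have q: "q x \<in> {1..b}" "x + (a + 1) \<in> {1..M}" if "x \<in> {1..b}" for x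
  proof -
    show x: "x + (a + 1) \<in> {1..M}" using that M by simp
    have "f (x + (a + 1)) < f 1" using cut(3)[OF x] ea by simp
    moreover have "f (x + (a + 1)) \<noteq> b + 1" using f_inj[OF x, of "a + 1"] fe that cut(2) ea by auto
    moreover have "1 \<le> f (x + (a + 1))" using f_range[OF x] by simp
    ultimately show "q x \<in> {1..b}" unfolding q_def atLeastAtMost_iff using f1 by linarith
  qed
  have "alternating_baxter a h"
  proof
    show "4 dvd a + 1" by (fact a4)
    show "bij_betw h {1..a} {1..a}"
    proof (rule bij_betw_endoI)
      show "inj_on h {1..a}"
        by (rule inj_onI) (metis h(1,3) f_inj)
    qed (fact h(2))
    show "even (h x) \<longleftrightarrow> even x" if "x \<in> {1..a}" for x
    proof -
      have "even (b + 1)" using b4 by presburger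
      then show ?thesis using parity[OF h(3)[OF that]] unfolding h(1)[OF that] by (metis even_add)
    qed
    show "h z < h x" if "x \<in> {1..a}" "y \<in> {1..a}" "z \<in> {1..a}" "h y = h x + 1" "odd (h x)"
      "x < z \<and> z < y \<or> y < z \<and> z < x" for x y z
    proof -
      have "f y = f x + 1" "odd (f x)" using h(1)[OF that(1)] h(1)[OF that(2)] that(4,5) b4 by presburger+
      from below[OF h(3)[OF that(1)] h(3)[OF that(2)] h(3)[OF that(3)] this that(6)]
      show ?thesis using h(1)[OF that(1)] h(1)[OF that(3)] by simp
    qed
    show "h y < h z" if "x \<in> {1..a}" "y \<in> {1..a}" "z \<in> {1..a}" "h y = h x + 1" "even (h x)"
      "x < z \<and> z < y \<or> y < z \<and> z < x" for x y z
    proof -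
      have "f y = f x + 1" "even (f x)" using h(1)[OF that(1)] h(1)[OF that(2)] that(4,5) b4 by presburger+
      from above[OF h(3)[OF that(1)] h(3)[OF that(2)] h(3)[OF that(3)] this that(6)]
      show ?thesis using h(1)[OF that(2)] h(1)[OF that(3)] by simp
    qed
    show "h x < h (x + 2) \<longleftrightarrow> 4 dvd x + 3" if "odd x" "x + 2 \<le> a" for x
    proof -
      have "x \<in> {1..a}" "x + 2 \<in> {1..a}" using that by (cases x; auto)+
      then show ?thesis using columns[OF that(1)] that(2) M h(1)[of x] h(1)[of "x + 2"] by simp
    qed
    show "x < y \<longleftrightarrow> 4 dvd h x + 3" if "x \<in> {1..a}" "y \<in> {1..a}" "odd (h x)" "h y = h x + 2" for x y
    proof -
      have "f y = f x + 2" "odd (f x)" "4 dvd f x + 3 \<longleftrightarrow> 4 dvd h x + 3"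
        using h(1)[OF that(1)] h(1)[OF that(2)] that(3,4) b4 by presburger+
      then show ?thesis using rows[OF h(3)[OF that(1)] h(3)[OF that(2)]] by simp
    qed
  qed
  moreover have "alternating_baxter b q"
  proof
    show "4 dvd b + 1" by (fact b4)
    show "bij_betw q {1..b} {1..b}"
    proof (rule bij_betw_endoI)
      show "inj_on q {1..b}"
      proof (rule inj_onI)
        fix x y assume "x \<in> {1..b}" "y \<in> {1..b}" "q x = q y"
        then show "x = y" using f_inj[OF q(2) q(2), of x y] unfolding q_def by simp
      qed
    qed (fact q(1))
    show "even (q x) \<longleftrightarrow> even x" if "x \<in> {1..b}" for x
    proof -
      have "even (a + 1)" using a4 by presburger
      then show ?thesis using parity[OF q(2)[OF that]] unfolding q_def by (metis even_add)
    qed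
    show "q z < q x" if "x \<in> {1..b}" "y \<in> {1..b}" "z \<in> {1..b}" "q y = q x + 1" "odd (q x)"
      "x < z \<and> z < y \<or> y < z \<and> z < x" for x y z
      using below[OF q(2)[OF that(1)] q(2)[OF that(2)] q(2)[OF that(3)]] that(4-6) unfolding q_def by simp
    show "q y < q z" if "x \<in> {1..b}" "y \<in> {1..b}" "z \<in> {1..b}" "q y = q x + 1" "even (q x)"
      "x < z \<and> z < y \<or> y < z \<and> z < x" for x y z
      using above[OF q(2)[OF that(1)] q(2)[OF that(2)] q(2)[OF that(3)]] that(4-6) unfolding q_def by simp
    show "q x < q (x + 2) \<longleftrightarrow> 4 dvd x + 3" if "odd x" "x + 2 \<le> b" for x
    proof -
      have "odd (x + (a + 1))" "x + (a + 1) + 2 \<le> M" "4 dvd x + 3 \<longleftrightarrow> 4 dvd x + (a + 1) + 3"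
        using that M a4 by presburger+
      moreover have "x + (a + 1) + 2 = x + 2 + (a + 1)" by simp
      ultimately show ?thesis using columns[of "x + (a + 1)"] unfolding q_def by metis
    qed
    show "x < y \<longleftrightarrow> 4 dvd q x + 3" if "x \<in> {1..b}" "y \<in> {1..b}" "odd (q x)" "q y = q x + 2" for x y
      using rows[OF q(2)[OF that(1)] q(2)[OF that(2)]] that(3,4) unfolding q_def by simp
  qed
  moreover have "h 1 = 1" using f1 unfolding h_def by simp
  moreover have "f x = skew_glue a h b q x" if "x \<in> {1..M}" for x
  proof -
    consider "x \<le> a" | "x = a + 1" | "a + 1 < x" by linarith
    then show ?thesis
    proof cases
      case 1 then show ?thesis using h(1)[of x] that by (simp add: skew_glue_def)
    next
      case 2 then show ?thesis using fe by (simp add: skew_glue_def)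
    next
      case 3 then show ?thesis by (simp add: skew_glue_def q_def)
    qed
  qed
  ultimately show thesis using that M by blast
qed

text \<open>
  As \<open>1\<close> comes first and \<open>M\<close> last, the Baxter condition for \<open>1, 2\<close> and for \<open>M - 1, M\<close> leaves no room
  between the members of either pair.  So \<open>2\<close> is second and \<open>M - 1\<close> last but one, and what remains
  is the complement of a shorter permutation of the same kind.
\<close>

lemma frame_decomposition:
  assumes f1: "f 1 = 1" and "M \<noteq> 3"
  obtains b q where "M = b + 4" "alternating_baxter b q"
    "\<And>x. x \<in> {1..M} \<Longrightarrow> f x = framed_complement b q x"
proof -
  have "4 \<le> M" using M_ge_3 \<open>M \<noteq> 3\<close> by linarith
  then obtain b where "M = 4 + b" using le_Suc_ex by blast
  then have M: "M = b + 4" by simp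
  have b4: "4 dvd b + 1" using len M by presburger
  have ends: "1 \<in> {1..M}" "2 \<in> {1..M}" "b + 3 \<in> {1..M}" "M \<in> {1..M}" using M by auto
  have fM: "f M = M" using starts_with_1_imp_ends_with_M f1 by simp
  have f2: "f 2 = 2"
  proof (rule ccontr)
    assume "f 2 \<noteq> 2"
    define y where "y = pos 2"
    have y: "y \<in> {1..M}" "f y = f 1 + 1" using f_pos[OF ends(2)] pos_range[OF ends(2)] f1 unfolding y_def by simp_all
    have "y \<noteq> 1" "y \<noteq> 2" using y(2) f1 \<open>f 2 \<noteq> 2\<close> by auto
    then have "1 < (2::nat) \<and> 2 < y" using y(1) by auto
    then have "f 2 < f 1" using below[OF ends(1) y(1) ends(2) y(2)] f1 by simp
    then show False using f1 f_range[OF ends(2)] by simp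
  qed
  have f3: "f (b + 3) = b + 3"
  proof (rule ccontr)
    assume ne: "f (b + 3) \<noteq> b + 3"
    define y where "y = pos (b + 3)"
    have y: "y \<in> {1..M}" "f y = b + 3" using f_pos[OF ends(3)] pos_range[OF ends(3)] unfolding y_def by simp_all
    have "y \<noteq> M" "y \<noteq> b + 3" using y ne fM M by auto
    then have "y < b + 3 \<and> b + 3 < M" using y(1) M by auto
    moreover have "f M = f y + 1" using y(2) fM M by simp
    moreover have "even (f y)" unfolding y(2) using b4 by presburger
    ultimately have "f M < f (b + 3)" using above[OF y(1) ends(4) ends(3)] by simp
    then show False using fM f_range[OF ends(3)] by simp
  qed
  define q where "q x = b + 3 - f (x + 2)" for x
  have q: "f (x + 2) + q x = b + 3" "q x \<in> {1..b}" "x + 2 \<in> {1..M}" if "x \<in> {1..b}" for x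
  proof -
    show x: "x + 2 \<in> {1..M}" using that M by simp
    have "f (x + 2) \<noteq> 1" "f (x + 2) \<noteq> 2" "f (x + 2) \<noteq> b + 3" "f (x + 2) \<noteq> M"
      using f_inj[OF x ends(1)] f_inj[OF x ends(2)] f_inj[OF x ends(3)] f_inj[OF x ends(4)]
        f1 f2 f3 fM that M by auto
    then have "3 \<le> f (x + 2)" "f (x + 2) \<le> b + 2" using f_range[OF x] M unfolding atLeastAtMost_iff by linarith+
    then show "f (x + 2) + q x = b + 3" "q x \<in> {1..b}" unfolding q_def by auto
  qed
  have "alternating_baxter b q"
  proof
    show "4 dvd b + 1" by (fact b4)
    show "bij_betw q {1..b} {1..b}"
    proof (rule bij_betw_endoI)
      show "inj_on q {1..b}"
      proof (rule inj_onI)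
        fix x y assume xy: "x \<in> {1..b}" "y \<in> {1..b}" "q x = q y"
        then have "f (x + 2) = f (y + 2)" using q(1)[OF xy(1)] q(1)[OF xy(2)] by linarith
        then show "x = y" using f_inj[OF q(3) q(3)] xy(1,2) by simp
      qed
    qed (fact q(2))
    show "even (q x) \<longleftrightarrow> even x" if "x \<in> {1..b}" for x
    proof -
      have "even (f (x + 2) + q x)" using b4 unfolding q(1)[OF that] by presburger
      then show ?thesis using parity[OF q(3)[OF that]] by simp
    qed
    show "q z < q x" if "x \<in> {1..b}" "y \<in> {1..b}" "z \<in> {1..b}" "q y = q x + 1" "odd (q x)"
      "x < z \<and> z < y \<or> y < z \<and> z < x" for x y z
    proof -
      have "f (x + 2) = f (y + 2) + 1" "even (f (y + 2))"
        using q(1)[OF that(1)] q(1)[OF that(2)] that(4,5) b4 by presburger+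
      from above[OF q(3)[OF that(2)] q(3)[OF that(1)] q(3)[OF that(3)] this]
      show ?thesis using that(6) q(1)[OF that(1)] q(1)[OF that(3)] by auto
    qed
    show "q y < q z" if "x \<in> {1..b}" "y \<in> {1..b}" "z \<in> {1..b}" "q y = q x + 1" "even (q x)"
      "x < z \<and> z < y \<or> y < z \<and> z < x" for x y z
    proof -
      have "f (x + 2) = f (y + 2) + 1" "odd (f (y + 2))"
        using q(1)[OF that(1)] q(1)[OF that(2)] that(4,5) b4 by presburger+
      from below[OF q(3)[OF that(2)] q(3)[OF that(1)] q(3)[OF that(3)] this]
      show ?thesis using that(6) q(1)[OF that(2)] q(1)[OF that(3)] by auto
    qed
    show "q x < q (x + 2) \<longleftrightarrow> 4 dvd x + 3" if "odd x" "x + 2 \<le> b" for x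
    proof -
      have x: "x \<in> {1..b}" "x + 2 \<in> {1..b}" using that by (cases x; auto)+
      have "f (x + 2) < f (x + 2 + 2) \<longleftrightarrow> \<not> 4 dvd x + 3"
        using columns[of "x + 2"] that M by (simp, presburger)
      moreover have "f (x + 2) \<noteq> f (x + 2 + 2)" using f_inj[OF q(3)[OF x(1)] q(3)[OF x(2)]] by simp
      ultimately show ?thesis using q(1)[OF x(1)] q(1)[OF x(2)] by linarith
    qed
    show "x < y \<longleftrightarrow> 4 dvd q x + 3" if "x \<in> {1..b}" "y \<in> {1..b}" "odd (q x)" "q y = q x + 2" for x y
    proof -
      have "f (x + 2) = f (y + 2) + 2" "odd (f (y + 2))" "4 dvd q x + 3 \<longleftrightarrow> \<not> 4 dvd f (y + 2) + 3"
        using q(1)[OF that(1)] q(1)[OF that(2)] that(3,4) b4 by presburger+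
      moreover have "x \<noteq> y" using that(4) by auto
      ultimately show ?thesis using rows[OF q(3)[OF that(2)] q(3)[OF that(1)]] by auto
    qed
  qed
  moreover have "f x = framed_complement b q x" if "x \<in> {1..M}" for x
  proof -
    have "1 \<le> x" "x \<le> M" using that by auto
    then consider "x = 1" | "x = 2" | "3 \<le> x" "x \<le> b + 2" | "x = b + 3" | "x = M"
      using M by linarith
    then show ?thesis
    proof cases
      case 3
      then have "x - 2 \<in> {1..b}" "x - 2 + 2 = x" by auto
      then have "f x + q (x - 2) = b + 3" using q(1)[of "x - 2"] by simp
      then have "f x = b + 3 - q (x - 2)" by linarith
      then show ?thesis using 3 by (simp add: framed_complement_def)
    qed (use f1 f2 f3 fM M in \<open>simp_all add: framed_complement_def\<close>)
  qed
  ultimately show thesis using that M by blast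
qed

end

section \<open>One-line notation\<close>

lemma is_perm_iff: "is_perm p \<longleftrightarrow> set p = {1..length p} \<and> distinct p"
  by (simp add: is_perm_def permutations_of_set_def)

lemma entry_map_upt: "i \<in> {1..n} \<Longrightarrow> entry (map f [1..<Suc n]) i = f i"
  by (auto simp: entry_def nth_append simp del: upt_Suc)

lemma map_entry_upt: "map (entry p) [1..<Suc (length p)] = p"
  by (rule nth_equalityI) (auto simp: entry_def simp del: upt_Suc)

lemma is_perm_map_upt: "is_perm (map f [1..<Suc n]) \<longleftrightarrow> bij_betw f {1..n} {1..n}"
  by (auto simp: is_perm_iff bij_betw_def distinct_map atLeastLessThanSuc_atLeastAtMost simp del: upt_Suc)

lemma bij_betw_entry: "is_perm p \<Longrightarrow> bij_betw (entry p) {1..length p} {1..length p}"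
  using is_perm_map_upt[of "entry p" "length p"] by (simp only: map_entry_upt)

text \<open>
  For a permutation these are the standardizations of the even and of the odd entries; being given by
  an explicit formula, they commute with concatenation and with even shifts.
\<close>

definition even_halves :: "nat list \<Rightarrow> nat list" where
  "even_halves xs = map (\<lambda>v. v div 2) (filter even xs)"

definition odd_halves :: "nat list \<Rightarrow> nat list" where
  "odd_halves xs = map (\<lambda>v. (v + 1) div 2) (filter odd xs)"

lemma card_even_upto: "card {w \<in> {1..n}. even w} = n div 2"
proof -
  have "{w \<in> {1..n}. even w} = (\<lambda>i. 2 * i) ` {1..n div 2}"
    by (auto elim!: evenE simp: image_iff)
  then show ?thesis by (simp add: card_image inj_on_def)
qed

lemma card_odd_upto: "card {w \<in> {1..n}. odd w} = (n + 1) div 2"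
proof -
  have "{w \<in> {1..n}. odd w} = (\<lambda>i. 2 * i + 1) ` {..<(n + 1) div 2}"
    by (auto elim!: oddE simp: image_iff)
  then show ?thesis by (simp add: card_image inj_on_def)
qed

lemma even_part_eq: "is_perm p \<Longrightarrow> even_part p = even_halves p"
  unfolding even_part_def standardization_def even_halves_def
proof (rule map_cong[OF refl])
  fix v assume "is_perm p" and v: "v \<in> set (filter even p)"
  then have "{w \<in> set (filter even p). w \<le> v} = {w \<in> {1..v}. even w}"
    unfolding is_perm_iff by auto
  then show "card {w \<in> set (filter even p). w \<le> v} = v div 2" by (simp only: card_even_upto)
qed

lemma odd_part_eq: "is_perm p \<Longrightarrow> odd_part p = odd_halves p"
  unfolding odd_part_def standardization_def odd_halves_def
proof (rule map_cong[OF refl])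
  fix v assume "is_perm p" and v: "v \<in> set (filter odd p)"
  then have "{w \<in> set (filter odd p). w \<le> v} = {w \<in> {1..v}. odd w}"
    unfolding is_perm_iff by auto
  then show "card {w \<in> set (filter odd p). w \<le> v} = (v + 1) div 2" by (simp only: card_odd_upto)
qed

lemma length_halves:
  assumes "is_perm p"
  shows "length (even_halves p) = length p div 2" "length (odd_halves p) = (length p + 1) div 2"
proof -
  have "length (filter Q p) = card {w \<in> {1..length p}. Q w}" for Q
    using assms distinct_card[of "filter Q p"] unfolding is_perm_iff by (metis distinct_filter set_filter)
  then show "length (even_halves p) = length p div 2" "length (odd_halves p) = (length p + 1) div 2"
    unfolding even_halves_def odd_halves_def by (simp_all only: length_map card_even_upto card_odd_upto)
qed

lemma filter_even_upt: "filter even [1..<Suc (2 * n + 1)] = map (\<lambda>i. 2 * i) [1..<Suc n]"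
  by (induction n) auto

lemma filter_odd_upt: "filter odd [1..<Suc (2 * n + 1)] = map (\<lambda>i. 2 * i - 1) [1..<Suc (Suc n)]"
  by (induction n) auto

text \<open>
  The permutation induced on the even entries of \<open>f\<close> when \<open>f\<close> preserves parity on positions
  \<open>1, \<dots>, 2 n + 1\<close>.
\<close>

definition even_entries :: "nat \<Rightarrow> (nat \<Rightarrow> nat) \<Rightarrow> nat list" where
  "even_entries n f = map (\<lambda>i. f (2 * i) div 2) [1..<Suc n]"

lemma even_halves_map:
  assumes "\<And>x. x \<in> {1..2 * n + 1} \<Longrightarrow> even (f x) \<longleftrightarrow> even x"
  shows "even_halves (map f [1..<Suc (2 * n + 1)]) = even_entries n f"
proof -
  have "filter (even \<circ> f) [1..<Suc (2 * n + 1)] = filter even [1..<Suc (2 * n + 1)]"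
    using assms by (intro filter_cong) (auto simp del: upt_Suc)
  then show ?thesis unfolding even_halves_def even_entries_def filter_map filter_even_upt
    by (simp del: upt_Suc add: o_def)
qed

lemma odd_halves_map:
  assumes "\<And>x. x \<in> {1..2 * n + 1} \<Longrightarrow> even (f x) \<longleftrightarrow> even x"
  shows "odd_halves (map f [1..<Suc (2 * n + 1)]) = map (\<lambda>i. (f (2 * i - 1) + 1) div 2) [1..<Suc (Suc n)]"
proof -
  have "filter (odd \<circ> f) [1..<Suc (2 * n + 1)] = filter odd [1..<Suc (2 * n + 1)]"
    using assms by (intro filter_cong) (auto simp del: upt_Suc)
  then show ?thesis unfolding odd_halves_def filter_map filter_odd_upt
    by (simp del: upt_Suc add: o_def)
qed

lemma alternating_iff:
  assumes "distinct p"
  shows "alternating p \<longleftrightarrow> (\<forall>i. 1 \<le> i \<and> i < length p \<longrightarrow> (entry p i < entry p (i + 1) \<longleftrightarrow> odd i))"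
proof -
  have ne: "entry p i \<noteq> entry p (i + 1)" if "1 \<le> i" "i < length p" for i
    using assms that by (simp add: entry_def nth_eq_iff_index_eq)
  show ?thesis
  proof
    assume alt: "alternating p"
    have *: "entry p (Suc i) < entry p (Suc i + 1) \<longleftrightarrow> odd (Suc i)" if "Suc i < length p" for i
      using that
    proof (induction i)
      case 0
      then show ?case using alt unfolding alternating_def ascent_def by simp
    next
      case (Suc i)
      then have "entry p (Suc i) < entry p (Suc i + 1) \<longleftrightarrow> entry p (Suc i + 1 + 1) < entry p (Suc i + 1)"
        using alt unfolding alternating_def ascent_def descent_def by simp
      then show ?case using Suc ne[of "Suc (Suc i)"] by simp linarith
    qed
    show "\<forall>i. 1 \<le> i \<and> i < length p \<longrightarrow> (entry p i < entry p (i + 1) \<longleftrightarrow> odd i)"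
    proof (intro allI impI)
      fix i assume "1 \<le> i \<and> i < length p"
      then show "entry p i < entry p (i + 1) \<longleftrightarrow> odd i" using *[of "i - 1"] by simp
    qed
  next
    assume r: "\<forall>i. 1 \<le> i \<and> i < length p \<longrightarrow> (entry p i < entry p (i + 1) \<longleftrightarrow> odd i)"
    show "alternating p"
      unfolding alternating_def ascent_def descent_def
    proof (intro conjI impI allI)
      show "entry p 1 < entry p (1 + 1)" if "2 \<le> length p" using r that by simp
      show "entry p i < entry p (i + 1) \<longleftrightarrow> entry p (i + 1 + 1) < entry p (i + 1)"
        if "1 \<le> i \<and> i + 2 \<le> length p" for i
      proof -
        have "entry p i < entry p (i + 1) \<longleftrightarrow> odd i" using r that by simp
        moreover have "entry p (i + 1) < entry p (i + 1 + 1) \<longleftrightarrow> odd (i + 1)" using r[rule_format, of "i + 1"] that by simp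
        ultimately show ?thesis using ne[of "i + 1"] that by (auto simp: not_less order.order_iff_strict)
      qed
    qed
  qed
qed

text \<open>
  The alternation of the inverse is expressed through the positions \<open>i\<close>, \<open>j\<close> of adjacent values, which
  avoids the inverse altogether.
\<close>

lemma doubly_alternating_iff:
  assumes "is_perm p"
  shows "doubly_alternating p \<longleftrightarrow>
    (\<forall>i. 1 \<le> i \<and> i < length p \<longrightarrow> (entry p i < entry p (i + 1) \<longleftrightarrow> odd i)) \<and>
    (\<forall>i \<in> {1..length p}. \<forall>j \<in> {1..length p}. entry p j = entry p i + 1 \<longrightarrow> (i < j \<longleftrightarrow> odd (entry p i)))"
proof -
  let ?A = "{1..length p}" and ?g = "inv_into {1..length p} (entry p)"
  have bij: "bij_betw (entry p) ?A ?A" using bij_betw_entry assms by simp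
  then have big: "bij_betw ?g ?A ?A" by (rule bij_betw_inv_into)
  have gr: "?g v \<in> ?A" if "v \<in> ?A" for v using big that by (rule bij_betw_apply)
  have pr: "entry p v \<in> ?A" if "v \<in> ?A" for v using bij that by (rule bij_betw_apply)
  have pg: "entry p (?g v) = v" if "v \<in> ?A" for v using bij that by (rule bij_betw_inv_into_right)
  have gp: "?g (entry p v) = v" if "v \<in> ?A" for v using bij that by (rule bij_betw_inv_into_left)
  have inv: "inverse_perm p = map ?g [1..<Suc (length p)]" by (simp only: inverse_perm_def Suc_eq_plus1)
  have "is_perm (inverse_perm p)" unfolding inv is_perm_map_upt by (fact big)
  then have d: "distinct p" "distinct (inverse_perm p)" using assms is_perm_iff by auto
  have len: "length (inverse_perm p) = length p" unfolding inv by (simp del: upt_Suc)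
  have ent: "entry (inverse_perm p) v = ?g v" if "v \<in> ?A" for v
    unfolding inv using that by (rule entry_map_upt)
  have "(\<forall>i. 1 \<le> i \<and> i < length p \<longrightarrow> (entry (inverse_perm p) i < entry (inverse_perm p) (i + 1) \<longleftrightarrow> odd i))
      \<longleftrightarrow> (\<forall>i \<in> ?A. \<forall>j \<in> ?A. entry p j = entry p i + 1 \<longrightarrow> (i < j \<longleftrightarrow> odd (entry p i)))"
    (is "?L \<longleftrightarrow> ?R")
  proof
    assume L: ?L
    show ?R
    proof (intro ballI impI)
      fix i j assume ij: "i \<in> ?A" "j \<in> ?A" "entry p j = entry p i + 1"
      let ?v = "entry p i"
      have v: "1 \<le> ?v \<and> ?v < length p" "?v + 1 \<in> ?A" using pr[OF ij(1)] pr[OF ij(2)] ij(3) by auto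
      have "?g ?v < ?g (?v + 1) \<longleftrightarrow> odd ?v"
        using L v(1) ent[OF pr[OF ij(1)]] ent[OF v(2)] by metis
      then show "i < j \<longleftrightarrow> odd ?v" using gp[OF ij(1)] gp[OF ij(2)] ij(3) by simp
    qed
  next
    assume R: ?R
    show ?L
    proof (intro allI impI)
      fix v assume v: "1 \<le> v \<and> v < length p"
      then have vA: "v \<in> ?A" "v + 1 \<in> ?A" by auto
      show "entry (inverse_perm p) v < entry (inverse_perm p) (v + 1) \<longleftrightarrow> odd v"
        unfolding ent[OF vA(1)] ent[OF vA(2)]
        using R gr[OF vA(1)] gr[OF vA(2)] pg[OF vA(1)] pg[OF vA(2)] by metis
    qed
  qed
  then show ?thesis
    unfolding doubly_alternating_def alternating_iff[OF d(1)] alternating_iff[OF d(2)] len by simp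
qed

lemma half_bij:
  assumes bij: "bij_betw f {1..2 * n + 1} {1..2 * n + 1}"
    and par: "\<And>x. x \<in> {1..2 * n + 1} \<Longrightarrow> even (f x) \<longleftrightarrow> even x"
  shows "is_perm (map (\<lambda>i. (f (2 * i - 1) + 1) div 2) [1..<Suc (Suc n)])"
    and "is_perm (even_entries n f)"
proof -
  have fr: "f x \<in> {1..2 * n + 1}" if "x \<in> {1..2 * n + 1}" for x using bij that by (rule bij_betw_apply)
  have fi: "x = y" if "x \<in> {1..2 * n + 1}" "y \<in> {1..2 * n + 1}" "f x = f y" for x y
    using bij that by (metis bij_betw_def inj_on_eq_iff)
  show "is_perm (map (\<lambda>i. (f (2 * i - 1) + 1) div 2) [1..<Suc (Suc n)])"
    unfolding is_perm_map_upt
  proof (rule bij_betw_endoI)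
    fix i assume "i \<in> {1..Suc n}"
    then have x: "2 * i - 1 \<in> {1..2 * n + 1}" by auto
    then show "(f (2 * i - 1) + 1) div 2 \<in> {1..Suc n}" using fr[OF x] by auto
  next
    show "inj_on (\<lambda>i. (f (2 * i - 1) + 1) div 2) {1..Suc n}"
    proof (rule inj_onI)
      fix i j assume ij: "i \<in> {1..Suc n}" "j \<in> {1..Suc n}" "(f (2 * i - 1) + 1) div 2 = (f (2 * j - 1) + 1) div 2"
      then have x: "2 * i - 1 \<in> {1..2 * n + 1}" "2 * j - 1 \<in> {1..2 * n + 1}" by auto
      have "odd (f (2 * i - 1))" "odd (f (2 * j - 1))" using par[OF x(1)] par[OF x(2)] ij(1,2) by auto
      then have "f (2 * i - 1) = f (2 * j - 1)" using ij(3) by presburger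
      then show "i = j" using fi[OF x] ij(1,2) by auto
    qed
  qed
  show "is_perm (even_entries n f)"
    unfolding even_entries_def is_perm_map_upt
  proof (rule bij_betw_endoI)
    fix i assume i: "i \<in> {1..n}"
    then have x: "2 * i \<in> {1..2 * n + 1}" by auto
    have "even (f (2 * i))" using par[OF x] by simp
    moreover have "1 \<le> f (2 * i)" "f (2 * i) \<le> 2 * n + 1" using fr[OF x] by auto
    ultimately have "1 \<le> f (2 * i) div 2 \<and> f (2 * i) div 2 \<le> n" by presburger
    then show "f (2 * i) div 2 \<in> {1..n}" by simp
  next
    show "inj_on (\<lambda>i. f (2 * i) div 2) {1..n}"
    proof (rule inj_onI)
      fix i j assume ij: "i \<in> {1..n}" "j \<in> {1..n}" "f (2 * i) div 2 = f (2 * j) div 2"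
      then have x: "2 * i \<in> {1..2 * n + 1}" "2 * j \<in> {1..2 * n + 1}" by auto
      have "even (f (2 * i))" "even (f (2 * j))" using par[OF x(1)] par[OF x(2)] by auto
      then have "f (2 * i) = f (2 * j)" using ij(3) by (metis dvd_div_mult_self)
      then show "i = j" using fi[OF x] by simp
    qed
  qed
qed

text \<open>
  Halving the odd entries turns the conditions on entries two positions apart and on values two apart
  into the alternation of the induced permutation and of its inverse.
\<close>

lemma alternating_baxter_iff:
  assumes n: "odd n"
  shows "alternating_baxter (2 * n + 1) f \<longleftrightarrow>
    complete_baxter (map f [1..<Suc (2 * n + 1)]) \<and> doubly_alternating (odd_part (map f [1..<Suc (2 * n + 1)]))"
    (is "?A \<longleftrightarrow> ?B \<and> ?D")
proof -
  let ?M = "2 * n + 1"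
  define p where "p = map f [1..<Suc ?M]"
  have lp: "length p = ?M" unfolding p_def by (simp del: upt_Suc)
  have e: "entry p x = f x" if "x \<in> {1..?M}" for x unfolding p_def using that by (rule entry_map_upt)
  have D: "?D \<longleftrightarrow> (\<forall>x. odd x \<and> x + 2 \<le> ?M \<longrightarrow> (f x < f (x + 2) \<longleftrightarrow> 4 dvd x + 3)) \<and>
    (\<forall>x \<in> {1..?M}. \<forall>y \<in> {1..?M}. odd (f x) \<and> f y = f x + 2 \<longrightarrow> (x < y \<longleftrightarrow> 4 dvd f x + 3))"
    if bij: "bij_betw f {1..?M} {1..?M}" and par: "\<And>x. x \<in> {1..?M} \<Longrightarrow> even (f x) \<longleftrightarrow> even x"
  proof -
    define t where "t = map (\<lambda>i. (f (2 * i - 1) + 1) div 2) [1..<Suc (Suc n)]"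
    have lt: "length t = Suc n" unfolding t_def by (simp del: upt_Suc)
    have et: "entry t i = (f (2 * i - 1) + 1) div 2" if "i \<in> {1..Suc n}" for i
      unfolding t_def using that by (rule entry_map_upt)
    have et': "f (2 * i - 1) + 1 = 2 * entry t i" "2 * i - 1 \<in> {1..?M}" if "i \<in> {1..Suc n}" for i
    proof -
      show x: "2 * i - 1 \<in> {1..?M}" using that by auto
      have "odd (f (2 * i - 1))" using par[OF x] that by auto
      then show "f (2 * i - 1) + 1 = 2 * entry t i" using et[OF that] by simp
    qed
    have "is_perm p" unfolding p_def is_perm_map_upt by (fact bij)
    then have "odd_part p = t" unfolding odd_part_eq[OF \<open>is_perm p\<close>] unfolding p_def t_def
      using odd_halves_map[of n f, OF par] by simp
    moreover have "is_perm t" unfolding t_def by (rule half_bij(1)[OF bij par])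
    ultimately have DA: "?D \<longleftrightarrow> (\<forall>i. 1 \<le> i \<and> i < Suc n \<longrightarrow> (entry t i < entry t (i + 1) \<longleftrightarrow> odd i)) \<and>
       (\<forall>i \<in> {1..Suc n}. \<forall>j \<in> {1..Suc n}. entry t j = entry t i + 1 \<longrightarrow> (i < j \<longleftrightarrow> odd (entry t i)))"
      using doubly_alternating_iff[of t] lt unfolding p_def by simp
    have half: "\<exists>i \<in> {1..Suc n}. x = 2 * i - 1" if "odd x" "x \<le> ?M" for x
    proof -
      from that(1) obtain k where k: "x = 2 * k + 1" by (rule oddE)
      then show ?thesis using that(2) by (intro bexI[of _ "k + 1"]) auto
    qed
    have "(\<forall>i. 1 \<le> i \<and> i < Suc n \<longrightarrow> (entry t i < entry t (i + 1) \<longleftrightarrow> odd i)) \<longleftrightarrow>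
      (\<forall>x. odd x \<and> x + 2 \<le> ?M \<longrightarrow> (f x < f (x + 2) \<longleftrightarrow> 4 dvd x + 3))" (is "?P \<longleftrightarrow> ?Q")
    proof -
      have key: "(entry t i < entry t (i + 1) \<longleftrightarrow> odd i) \<longleftrightarrow>
         (f (2 * i - 1) < f (2 * i - 1 + 2) \<longleftrightarrow> 4 dvd (2 * i - 1) + 3)" if "1 \<le> i" "i < Suc n" for i
      proof -
        have i: "i \<in> {1..Suc n}" "i + 1 \<in> {1..Suc n}" using that by auto
        have "2 * (i + 1) - 1 = 2 * i - 1 + 2" using that(1) by simp
        then have "f (2 * i - 1 + 2) + 1 = 2 * entry t (i + 1)" using et'(1)[OF i(2)] by simp
        then have "entry t i < entry t (i + 1) \<longleftrightarrow> f (2 * i - 1) < f (2 * i - 1 + 2)"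
          using et'(1)[OF i(1)] by linarith
        moreover have "odd i \<longleftrightarrow> 4 dvd (2 * i - 1) + 3" using that(1) by presburger
        ultimately show ?thesis by simp
      qed
      show ?thesis
      proof
        assume P: ?P
        show ?Q
        proof (intro allI impI)
          fix x assume x: "odd x \<and> x + 2 \<le> ?M"
          then have "\<exists>i \<in> {1..Suc n}. x = 2 * i - 1" by (intro half) auto
          then obtain i where i: "i \<in> {1..Suc n}" "x = 2 * i - 1" by blast
          then have "1 \<le> i" "i < Suc n" using x by auto
          then show "f x < f (x + 2) \<longleftrightarrow> 4 dvd x + 3" using key P i(2) by blast
        qed
      next
        assume Q: ?Q
        show ?P
        proof (intro allI impI)
          fix i assume i: "1 \<le> i \<and> i < Suc n"
          then have "odd (2 * i - 1) \<and> 2 * i - 1 + 2 \<le> ?M" by auto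
          then show "entry t i < entry t (i + 1) \<longleftrightarrow> odd i" using key Q i by blast
        qed
      qed
    qed
    moreover have "(\<forall>i \<in> {1..Suc n}. \<forall>j \<in> {1..Suc n}. entry t j = entry t i + 1 \<longrightarrow> (i < j \<longleftrightarrow> odd (entry t i))) \<longleftrightarrow>
      (\<forall>x \<in> {1..?M}. \<forall>y \<in> {1..?M}. odd (f x) \<and> f y = f x + 2 \<longrightarrow> (x < y \<longleftrightarrow> 4 dvd f x + 3))" (is "?P \<longleftrightarrow> ?Q")
    proof -
      have key: "(entry t j = entry t i + 1 \<longrightarrow> (i < j \<longleftrightarrow> odd (entry t i))) \<longleftrightarrow>
         (f (2 * j - 1) = f (2 * i - 1) + 2 \<longrightarrow> (2 * i - 1 < 2 * j - 1 \<longleftrightarrow> 4 dvd f (2 * i - 1) + 3))"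
        if ij: "i \<in> {1..Suc n}" "j \<in> {1..Suc n}" for i j
      proof -
        have "entry t j = entry t i + 1 \<longleftrightarrow> f (2 * j - 1) = f (2 * i - 1) + 2"
          using et'(1)[OF ij(1)] et'(1)[OF ij(2)] by linarith
        moreover have "i < j \<longleftrightarrow> 2 * i - 1 < 2 * j - 1" using ij by auto
        moreover have "odd (entry t i) \<longleftrightarrow> 4 dvd f (2 * i - 1) + 3" using et'(1)[OF ij(1)] by presburger
        ultimately show ?thesis by simp
      qed
      show ?thesis
      proof
        assume P: ?P
        show ?Q
        proof (intro ballI impI)
          fix x y assume x: "x \<in> {1..?M}" and y: "y \<in> {1..?M}" and f: "odd (f x) \<and> f y = f x + 2"
          then have od: "odd x" "odd y" using par[OF x] par[OF y] by auto
          have "x \<le> ?M" "y \<le> ?M" using x y by simp_all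
          from half[OF od(1) this(1)] half[OF od(2) this(2)]
          obtain i j where "i \<in> {1..Suc n}" "x = 2 * i - 1" "j \<in> {1..Suc n}" "y = 2 * j - 1" by blast
          then show "x < y \<longleftrightarrow> 4 dvd f x + 3" using key P f by blast
        qed
      next
        assume Q: ?Q
        show ?P
        proof (intro ballI)
          fix i j assume ij: "i \<in> {1..Suc n}" "j \<in> {1..Suc n}"
          have "odd (f (2 * i - 1))" using par[OF et'(2)[OF ij(1)]] ij(1) by auto
          then show "entry t j = entry t i + 1 \<longrightarrow> (i < j \<longleftrightarrow> odd (entry t i))"
            using key[OF ij] Q et'(2)[OF ij(1)] et'(2)[OF ij(2)] by blast
        qed
      qed
    qed
    ultimately show ?thesis unfolding DA by simp
  qed
  show ?thesis
  proof
    assume ?A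
    then interpret f: alternating_baxter ?M f .
    have "complete_baxter p"
      unfolding complete_baxter_def lp
    proof (intro conjI ballI allI impI)
      show "is_perm p" unfolding p_def is_perm_map_upt by (fact f.bij)
      show "odd ?M" by simp
      show "even (entry p i) \<longleftrightarrow> even i" if "i \<in> {1..?M}" for i using f.parity e that by simp
      fix x y z i
      assume x: "x \<in> {1..?M}" and y: "y \<in> {1..?M}" and z: "z \<in> {1..?M}"
        and h: "entry p x = i \<and> entry p y = i + 1 \<and> (x < z \<and> z < y \<or> y < z \<and> z < x)"
      then have h': "f x = i" "f y = f x + 1" "x < z \<and> z < y \<or> y < z \<and> z < x" using e by auto
      show "entry p z < i" if "odd i" using f.below[OF x y z h'(2) _ h'(3)] h'(1) that e[OF z] by simp
      show "i + 1 < entry p z" if "even i" using f.above[OF x y z h'(2) _ h'(3)] h'(1,2) that e[OF z] by simp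
    qed
    moreover have ?D using D[OF f.bij f.parity] f.columns f.rows by blast
    ultimately show "?B \<and> ?D" unfolding p_def by simp
  next
    assume BD: "?B \<and> ?D"
    then have B: "complete_baxter p" unfolding p_def by simp
    have bij: "bij_betw f {1..?M} {1..?M}" using B unfolding complete_baxter_def p_def is_perm_map_upt by simp
    have par: "even (f x) \<longleftrightarrow> even x" if "x \<in> {1..?M}" for x
    proof -
      have "\<forall>i\<in>{1..?M}. even (entry p i) \<longleftrightarrow> even i" using B unfolding complete_baxter_def lp by blast
      then show ?thesis using that e[OF that] by metis
    qed
    have bax: "(odd (f x) \<longrightarrow> f z < f x) \<and> (even (f x) \<longrightarrow> f x + 1 < f z)"
      if "x \<in> {1..?M}" "y \<in> {1..?M}" "z \<in> {1..?M}" "f y = f x + 1" "x < z \<and> z < y \<or> y < z \<and> z < x" for x y z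
      using B that e[OF that(1)] e[OF that(2)] e[OF that(3)] unfolding complete_baxter_def lp by metis
    have D': "\<And>x. odd x \<Longrightarrow> x + 2 \<le> ?M \<Longrightarrow> (f x < f (x + 2) \<longleftrightarrow> 4 dvd x + 3)"
      "\<And>x y. x \<in> {1..?M} \<Longrightarrow> y \<in> {1..?M} \<Longrightarrow> odd (f x) \<Longrightarrow> f y = f x + 2 \<Longrightarrow> (x < y \<longleftrightarrow> 4 dvd f x + 3)"
      using BD D[OF bij par] by blast+
    show ?A
    proof
      show "4 dvd ?M + 1" using n by presburger
      show "f z < f x" if "x \<in> {1..?M}" "y \<in> {1..?M}" "z \<in> {1..?M}" "f y = f x + 1" "odd (f x)"
        "x < z \<and> z < y \<or> y < z \<and> z < x" for x y z using bax[OF that(1-4,6)] that(5) by blast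
      show "f y < f z" if "x \<in> {1..?M}" "y \<in> {1..?M}" "z \<in> {1..?M}" "f y = f x + 1" "even (f x)"
        "x < z \<and> z < y \<or> y < z \<and> z < x" for x y z using bax[OF that(1-4,6)] that(4,5) by simp
    qed (fact bij par D')+
  qed
qed

section \<open>Snow leopard permutations of odd length and their threads\<close>

lemma even_entries_cong:
  assumes "\<And>x. x \<in> {1..2 * n + 1} \<Longrightarrow> f x = p x"
  shows "even_entries n f = even_entries n p"
  unfolding even_entries_def using assms by (intro map_cong) (auto simp del: upt_Suc)

lemma length_even_entries [simp]: "length (even_entries n f) = n"
  by (simp add: even_entries_def del: upt_Suc)

lemma nth_even_entries: "i < n \<Longrightarrow> even_entries n f ! i = f (2 * (i + 1)) div 2"
  by (simp add: even_entries_def del: upt_Suc)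

lemma even_entries_skew_glue:
  "even_entries (a + b + 1) (skew_glue (2 * a + 1) h (2 * b + 1) q) =
    map (\<lambda>v. b + 1 + v) (even_entries a h) @ [b + 1] @ even_entries b q" (is "?l = ?r")
proof (rule nth_equalityI)
  show "length ?l = length ?r" by simp
  fix i assume "i < length ?l"
  then have i: "i < a + b + 1" by simp
  consider "i < a" | "i = a" | "a < i" by linarith
  then show "?l ! i = ?r ! i"
  proof cases
    case 1
    then show ?thesis using i by (simp add: nth_even_entries nth_append skew_glue_def)
  next
    case 2
    then show ?thesis using i by (simp add: nth_even_entries nth_append skew_glue_def)
  next
    case 3
    then obtain k where k: "i = a + 1 + k" using less_imp_add_positive by (metis Suc_eq_plus1 le_Suc_ex Suc_leI)
    have "skew_glue (2 * a + 1) h (2 * b + 1) q (2 * (i + 1)) = q (2 * (k + 1))"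
      unfolding skew_glue_def k by simp
    then show ?thesis using i k by (simp add: nth_even_entries nth_append)
  qed
qed

lemma even_entries_framed_complement:
  assumes "alternating_baxter (2 * b + 1) q"
  shows "even_entries (b + 2) (framed_complement (2 * b + 1) q) =
    [1] @ map (\<lambda>v. b + 2 - v) (even_entries b q) @ [b + 2]" (is "?l = ?r")
proof (rule nth_equalityI)
  interpret q: alternating_baxter "2 * b + 1" q by fact
  show "length ?l = length ?r" by simp
  fix i assume "i < length ?l"
  then have i: "i < b + 2" by simp
  consider "i = 0" | "1 \<le> i" "i \<le> b" | "i = b + 1" using i by linarith
  then show "?l ! i = ?r ! i"
  proof cases
    case 2
    then obtain k where k: "i = Suc k" "k < b" by (cases i) auto
    have "2 * (k + 1) \<in> {1..2 * b + 1}" using k by simp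
    from q.f_range[OF this] q.parity[OF this]
    have "(2 * b + 4 - q (2 * (k + 1))) div 2 = b + 2 - q (2 * (k + 1)) div 2"
      by (auto elim!: evenE)
    then show ?thesis using k by (simp add: nth_even_entries nth_append framed_complement_def)
  qed (simp_all add: nth_even_entries nth_append framed_complement_def)
qed

text \<open>
  Threads only come from snow leopard permutations of odd length, the antipermutation included.
\<close>

definition odd_snow_leopard :: "xperm \<Rightarrow> bool" where
  "odd_snow_leopard \<pi> \<longleftrightarrow> snow_leopard \<pi> \<and> odd (plength \<pi>)"

lemma odd_snow_leopard_Anti [simp]: "odd_snow_leopard Anti"
  by (simp add: odd_snow_leopard_def)

lemma odd_snow_leopard_Perm_iff:
  "odd_snow_leopard (Perm s) \<longleftrightarrow>
    (\<exists>f. alternating_baxter (2 * length s + 1) f \<and> s = even_entries (length s) f)"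
proof
  assume "odd_snow_leopard (Perm s)"
  then obtain p where od: "odd (length s)" and p: "complete_baxter p" "length p = 2 * length s + 1"
    "even_part p = s" "doubly_alternating (odd_part p)"
    unfolding odd_snow_leopard_def by auto
  have pm: "p = map (entry p) [1..<Suc (2 * length s + 1)]" using map_entry_upt[of p] p(2) by simp
  have ab: "alternating_baxter (2 * length s + 1) (entry p)"
    unfolding alternating_baxter_iff[OF od] using p pm by metis
  have "s = even_halves p" using p(1,3) even_part_eq unfolding complete_baxter_def by metis
  also have "\<dots> = even_entries (length s) (entry p)"
    using even_halves_map[of "length s" "entry p"] alternating_baxter.parity[OF ab] pm by metis
  finally show "\<exists>f. alternating_baxter (2 * length s + 1) f \<and> s = even_entries (length s) f" using ab by blast
next
  assume "\<exists>f. alternating_baxter (2 * length s + 1) f \<and> s = even_entries (length s) f"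
  then obtain f where f: "alternating_baxter (2 * length s + 1) f" and s: "s = even_entries (length s) f" by blast
  interpret f: alternating_baxter "2 * length s + 1" f by fact
  have od: "odd (length s)" using f.len by presburger
  let ?p = "map f [1..<Suc (2 * length s + 1)]"
  have cb: "complete_baxter ?p" "doubly_alternating (odd_part ?p)"
    using f alternating_baxter_iff[OF od] by blast+
  have "even_part ?p = s"
    using cb(1) even_part_eq[of ?p] even_halves_map[of "length s" f] f.parity s
    unfolding complete_baxter_def by metis
  moreover have "length ?p = 2 * length s + 1" by (simp del: upt_Suc)
  ultimately show "odd_snow_leopard (Perm s)"
    using cb od unfolding odd_snow_leopard_def by auto
qed

lemma odd_snow_leopard_even_entries:
  "alternating_baxter (2 * n + 1) f \<Longrightarrow> odd_snow_leopard (Perm (even_entries n f))"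
  unfolding odd_snow_leopard_Perm_iff length_even_entries by blast

lemma odd_snow_leopard_is_perm:
  assumes "odd_snow_leopard (Perm s)"
  shows "is_perm s" "odd (length s)"
proof -
  obtain f where f: "alternating_baxter (2 * length s + 1) f" "s = even_entries (length s) f"
    using assms odd_snow_leopard_Perm_iff by blast
  interpret f: alternating_baxter "2 * length s + 1" f by fact
  show "is_perm s" using half_bij(2)[OF f.bij f.parity] f(2) by simp
  show "odd (length s)" using assms by (simp add: odd_snow_leopard_def)
qed

lemma skew_sum_Nil: "Perm p \<ominus> Perm [] = Perm p"
  by (simp add: map_idI)

abbreviation (input) frame :: "xperm \<Rightarrow> xperm" where
  "frame \<pi> \<equiv> (one_perm \<oplus> complement \<pi>) \<oplus> one_perm"

lemma frame_even_entries:
  assumes "alternating_baxter (2 * b + 1) q"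
  shows "frame (Perm (even_entries b q)) = Perm (even_entries (b + 2) (framed_complement (2 * b + 1) q))"
  unfolding even_entries_framed_complement[OF assms]
proof -
  interpret q: alternating_baxter "2 * b + 1" q by fact
  have "is_perm (even_entries b q)" using half_bij(2)[OF q.bij q.parity] .
  then show "frame (Perm (even_entries b q)) = Perm ([1] @ map (\<lambda>v. b + 2 - v) (even_entries b q) @ [b + 2])"
    unfolding is_perm_iff by (auto simp: Suc_diff_le)
qed

text \<open>
  The frame of an odd snow leopard permutation is again one, and it is never the antipermutation: the frame of
  \<open>Anti\<close> is the permutation of length one, which comes from the complete Baxter permutation \<open>123\<close>.
\<close>

lemma frame_odd_snow_leopard:
  assumes "odd_snow_leopard \<pi>"
  obtains a h where "alternating_baxter (2 * a + 1) h" "frame \<pi> = Perm (even_entries a h)"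
proof (cases \<pi>)
  case Anti
  have "alternating_baxter (2 * 1 + 1) (\<lambda>x. x)" using alternating_baxter_3 by (simp add: numeral_3_eq_3)
  moreover have "frame \<pi> = Perm (even_entries 1 (\<lambda>x. x))" by (simp add: Anti even_entries_def)
  ultimately show thesis by (rule that)
next
  case (Perm s)
  obtain q where q: "alternating_baxter (2 * length s + 1) q" and s: "s = even_entries (length s) q"
    using assms Perm odd_snow_leopard_Perm_iff by blast
  have "2 * length s + 1 + 4 = 2 * (length s + 2) + 1" by simp
  with alternating_baxter_framed_complement[OF q]
  have "alternating_baxter (2 * (length s + 2) + 1) (framed_complement (2 * length s + 1) q)"
    by (simp only:)
  then show thesis using that frame_even_entries[OF q] Perm s by metis
qed

lemma odd_snow_leopard_compose:
  assumes "odd_snow_leopard \<pi>\<^sub>1" "odd_snow_leopard \<pi>\<^sub>2"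
  shows "odd_snow_leopard (frame \<pi>\<^sub>1 \<ominus> (one_perm \<ominus> \<pi>\<^sub>2))"
proof -
  obtain a h where h: "alternating_baxter (2 * a + 1) h" and e: "frame \<pi>\<^sub>1 = Perm (even_entries a h)"
    using frame_odd_snow_leopard[OF assms(1)] .
  show ?thesis
  proof (cases \<pi>\<^sub>2)
    case Anti
    then have "frame \<pi>\<^sub>1 \<ominus> (one_perm \<ominus> \<pi>\<^sub>2) = Perm (even_entries a h)" using e skew_sum_Nil by simp
    then show ?thesis using odd_snow_leopard_even_entries[OF h] by metis
  next
    case (Perm s)
    obtain q where q: "alternating_baxter (2 * length s + 1) q" and s: "s = even_entries (length s) q"
      using assms(2) Perm odd_snow_leopard_Perm_iff by blast
    let ?f = "skew_glue (2 * a + 1) h (2 * length s + 1) q" and ?n = "a + length s + 1"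
    have "2 * a + 1 + (2 * length s + 1) + 1 = 2 * ?n + 1" by simp
    with alternating_baxter_skew_glue[OF h q] have "alternating_baxter (2 * ?n + 1) ?f"
      by (simp only:)
    moreover have "frame \<pi>\<^sub>1 \<ominus> (one_perm \<ominus> \<pi>\<^sub>2) = Perm (even_entries ?n ?f)"
      unfolding even_entries_skew_glue e Perm using s by simp
    ultimately show ?thesis using odd_snow_leopard_even_entries by metis
  qed
qed

text \<open>
  A block that starts with \<open>1\<close> is either \<open>123\<close>, the frame of \<open>Anti\<close>, or a proper framed complement.
\<close>

lemma block_is_frame:
  assumes "alternating_baxter (2 * a + 1) h" "h 1 = 1"
  obtains \<pi> where "odd_snow_leopard \<pi>" "frame \<pi> = Perm (even_entries a h)"
proof (cases "2 * a + 1 = 3")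
  case True
  interpret h: alternating_baxter "2 * a + 1" h by fact
  have a: "a = 1" using True by simp
  have "2 \<in> {1..2 * a + 1}" using a by simp
  from h.f_range[OF this] h.parity[OF this] have "h 2 = 2" unfolding a atLeastAtMost_iff by presburger
  then have "even_entries a h = [1]" unfolding a even_entries_def by simp
  then show thesis using that[of Anti] by simp
next
  case False
  interpret h: alternating_baxter "2 * a + 1" h by fact
  obtain b' q where b': "2 * a + 1 = b' + 4" and q: "alternating_baxter b' q"
    and eq: "\<And>x. x \<in> {1..2 * a + 1} \<Longrightarrow> h x = framed_complement b' q x"
    using h.frame_decomposition[OF assms(2) False] by metis
  have "odd b'" using b' by presburger
  then obtain b where b: "b' = 2 * b + 1" by (rule oddE)
  have ab: "a = b + 2" using b b' by simp
  have "even_entries a h = even_entries (b + 2) (framed_complement (2 * b + 1) q)"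
    using even_entries_cong[OF eq] unfolding ab b .
  then have "frame (Perm (even_entries b q)) = Perm (even_entries a h)"
    using frame_even_entries q unfolding b by simp
  moreover have "odd_snow_leopard (Perm (even_entries b q))"
    using odd_snow_leopard_even_entries q unfolding b by blast
  ultimately show thesis using that by blast
qed

text \<open>
  A skew cut of the complete Baxter permutation splits off the second summand; without a cut
  the permutation is a single block and the second summand is \<open>Anti\<close>, which cancels the middle \<open>1\<close>.
\<close>

lemma odd_snow_leopard_decompose:
  assumes "odd_snow_leopard (Perm s)"
  obtains \<pi>\<^sub>1 \<pi>\<^sub>2 where "odd_snow_leopard \<pi>\<^sub>1" "odd_snow_leopard \<pi>\<^sub>2"
    "Perm s = frame \<pi>\<^sub>1 \<ominus> (one_perm \<ominus> \<pi>\<^sub>2)"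
proof -
  obtain f where f: "alternating_baxter (2 * length s + 1) f" and s: "s = even_entries (length s) f"
    using assms odd_snow_leopard_Perm_iff by blast
  interpret f: alternating_baxter "2 * length s + 1" f by fact
  show thesis
  proof (cases "f 1 = 1")
    case True
    then obtain \<pi> where "odd_snow_leopard \<pi>" "frame \<pi> = Perm s"
      using block_is_frame[OF f] s by metis
    moreover from this(2) have "frame \<pi> \<ominus> (one_perm \<ominus> Anti) = Perm s" using skew_sum_Nil by simp
    ultimately show thesis using that[of \<pi> Anti] by simp
  next
    case False
    obtain a' b' h q where M: "2 * length s + 1 = a' + b' + 1" and h: "alternating_baxter a' h" "h 1 = 1"
      and q: "alternating_baxter b' q"
      and eq: "\<And>x. x \<in> {1..2 * length s + 1} \<Longrightarrow> f x = skew_glue a' h b' q x"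
      using f.skew_decomposition[OF False] by metis
    obtain a where a: "a' = 2 * a + 1" using alternating_baxter.odd_M[OF h(1)] by (rule oddE)
    obtain b where b: "b' = 2 * b + 1" using alternating_baxter.odd_M[OF q] by (rule oddE)
    have n: "length s = a + b + 1" using M a b by simp
    obtain \<pi> where \<pi>: "odd_snow_leopard \<pi>" "frame \<pi> = Perm (even_entries a h)"
      using block_is_frame h unfolding a by metis
    have "s = even_entries (a + b + 1) f" using s unfolding n .
    also have "\<dots> = even_entries (a + b + 1) (skew_glue (2 * a + 1) h (2 * b + 1) q)"
      by (rule even_entries_cong) (rule eq[unfolded n a b])
    finally have sum: "Perm s = frame \<pi> \<ominus> (one_perm \<ominus> Perm (even_entries b q))"
      unfolding even_entries_skew_glue \<pi>(2) by simp
    have "odd_snow_leopard (Perm (even_entries b q))"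
      using odd_snow_leopard_even_entries q unfolding b by blast
    from that[OF \<pi>(1) this sum] show thesis .
  qed
qed

lemma halves_append [simp]:
  "even_halves (xs @ ys) = even_halves xs @ even_halves ys"
  "odd_halves (xs @ ys) = odd_halves xs @ odd_halves ys"
  by (simp_all add: even_halves_def odd_halves_def)

lemma halves_shift:
  assumes "even k"
  shows "even_halves (map (\<lambda>v. k + v) xs) = map (\<lambda>v. k div 2 + v) (even_halves xs)"
    and "odd_halves (map (\<lambda>v. k + v) xs) = map (\<lambda>v. k div 2 + v) (odd_halves xs)"
  using assms by (auto simp: even_halves_def odd_halves_def filter_map o_def elim!: evenE)

text \<open>
  The entry that precedes a genuine permutation \<open>\<pi>\<close> in \<open>1 \<ominus> \<pi>\<close> is even, so it shows up in the even
  thread only.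
\<close>

lemma threads_of_lower_block:
  assumes "odd_snow_leopard \<pi>"
  obtains t where "one_perm \<ominus> \<pi> = Perm t" "even (length t)"
    "one_perm \<ominus> evens \<pi> = Perm (even_halves t)" "length (even_halves t) = length t div 2"
    "odds \<pi> = Perm (odd_halves t)" "length (odd_halves t) = length t div 2"
proof (cases \<pi>)
  case Anti
  then show thesis using that[of "[]"] by (simp add: even_halves_def odd_halves_def)
next
  case (Perm s)
  then have s: "is_perm s" "odd (length s)" using assms odd_snow_leopard_is_perm by auto
  obtain n where n: "length s = 2 * n + 1" using s(2) by (rule oddE)
  have "even_halves ((length s + 1) # s) = (n + 1) # even_halves s" "odd_halves ((length s + 1) # s) = odd_halves s"
    by (simp_all add: n even_halves_def odd_halves_def)
  then show thesis
    using that[of "(length s + 1) # s"] length_halves[OF s(1)]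
    by (simp add: Perm even_part_eq[OF s(1)] odd_part_eq[OF s(1)] n)
qed

text \<open>
  In the frame of \<open>\<pi>\<close>, the complement of \<open>\<pi>\<close> is shifted so that parities are exchanged, and the first
  and last entries are odd.  Hence the even entries come from the odd entries of \<open>\<pi>\<close>, and the odd ones
  from its even entries together with the frame.
\<close>

lemma threads_of_frame:
  assumes "odd_snow_leopard \<pi>"
  obtains x where "frame \<pi> = Perm x" "complement (odds \<pi>) = Perm (even_halves x)" "frame (evens \<pi>) = Perm (odd_halves x)"
proof (cases \<pi>)
  case Anti
  then show thesis using that[of "[1]"] by (simp add: even_halves_def odd_halves_def)
next
  case (Perm s)
  then have s: "is_perm s" "odd (length s)" using assms odd_snow_leopard_is_perm by auto
  obtain n where n: "length s = 2 * n + 1" using s(2) by (rule oddE)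
  have le: "v \<le> 2 * n + 1" if "v \<in> set s" for v using s(1) that n unfolding is_perm_iff by auto
  define c where "c = map (\<lambda>v. Suc (2 * n + 2 - v)) s"
  have fr: "frame \<pi> = Perm (1 # c @ [2 * n + 3])" by (simp add: Perm c_def n)
  have "filter even c = map (\<lambda>v. Suc (2 * n + 2 - v)) (filter odd s)"
    unfolding c_def filter_map by (intro arg_cong2[of _ _ _ _ map] filter_cong refl) (use le in force)
  then have "even_halves c = map (\<lambda>v. Suc (2 * n + 2 - v) div 2) (filter odd s)"
    by (simp add: even_halves_def)
  also have "\<dots> = map (\<lambda>v. n + 2 - v) (odd_halves s)"
    unfolding odd_halves_def map_map
    by (rule map_cong[OF refl]) (use le in \<open>force elim!: oddE\<close>)
  finally have e: "even_halves c = map (\<lambda>v. n + 2 - v) (odd_halves s)" .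
  have "filter odd c = map (\<lambda>v. Suc (2 * n + 2 - v)) (filter even s)"
    unfolding c_def filter_map by (intro arg_cong2[of _ _ _ _ map] filter_cong refl) (use le in force)
  then have "odd_halves c = map (\<lambda>v. (Suc (2 * n + 2 - v) + 1) div 2) (filter even s)"
    by (simp add: odd_halves_def)
  also have "\<dots> = map (\<lambda>v. Suc (n + 1 - v)) (even_halves s)"
    unfolding even_halves_def map_map
    by (rule map_cong[OF refl]) (use le in \<open>force elim!: evenE\<close>)
  finally have o: "odd_halves c = map (\<lambda>v. Suc (n + 1 - v)) (even_halves s)" .
  have "complement (odds \<pi>) = Perm (even_halves (1 # c @ [2 * n + 3]))"
    using e length_halves(2)[OF s(1)]
    by (simp add: Perm odd_part_eq[OF s(1)] n) (simp add: even_halves_def)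
  moreover have "frame (evens \<pi>) = Perm (odd_halves (1 # c @ [2 * n + 3]))"
    using o length_halves(1)[OF s(1)]
    by (simp add: Perm even_part_eq[OF s(1)] n) (simp add: odd_halves_def)
  ultimately show thesis using that fr by blast
qed

text \<open>
  Each thread of the composition mixes one thread of \<open>\<pi>\<^sub>1\<close> with one thread of \<open>\<pi>\<^sub>2\<close>, so the two
  threads can be prescribed independently of each other.
\<close>

lemma threads_of_composition:
  assumes "odd_snow_leopard \<pi>\<^sub>1" "odd_snow_leopard \<pi>\<^sub>2"
  shows "evens (frame \<pi>\<^sub>1 \<ominus> (one_perm \<ominus> \<pi>\<^sub>2)) = complement (odds \<pi>\<^sub>1) \<ominus> (one_perm \<ominus> evens \<pi>\<^sub>2)"
    and "odds (frame \<pi>\<^sub>1 \<ominus> (one_perm \<ominus> \<pi>\<^sub>2)) = frame (evens \<pi>\<^sub>1) \<ominus> odds \<pi>\<^sub>2"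
proof -
  obtain x where x: "frame \<pi>\<^sub>1 = Perm x" "complement (odds \<pi>\<^sub>1) = Perm (even_halves x)"
    "frame (evens \<pi>\<^sub>1) = Perm (odd_halves x)" using threads_of_frame[OF assms(1)] .
  obtain t where t: "one_perm \<ominus> \<pi>\<^sub>2 = Perm t" "even (length t)"
    "one_perm \<ominus> evens \<pi>\<^sub>2 = Perm (even_halves t)" "length (even_halves t) = length t div 2"
    "odds \<pi>\<^sub>2 = Perm (odd_halves t)" "length (odd_halves t) = length t div 2"
    using threads_of_lower_block[OF assms(2)] .
  let ?s = "map (\<lambda>v. length t + v) x @ t"
  have s: "frame \<pi>\<^sub>1 \<ominus> (one_perm \<ominus> \<pi>\<^sub>2) = Perm ?s" unfolding x t by simp
  then have p: "is_perm ?s" using odd_snow_leopard_compose[OF assms] odd_snow_leopard_is_perm(1) by simp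
  show "evens (frame \<pi>\<^sub>1 \<ominus> (one_perm \<ominus> \<pi>\<^sub>2)) = complement (odds \<pi>\<^sub>1) \<ominus> (one_perm \<ominus> evens \<pi>\<^sub>2)"
    unfolding s x t by (simp add: even_part_eq[OF p] halves_shift[OF t(2)] t(4))
  show "odds (frame \<pi>\<^sub>1 \<ominus> (one_perm \<ominus> \<pi>\<^sub>2)) = frame (evens \<pi>\<^sub>1) \<ominus> odds \<pi>\<^sub>2"
    unfolding s x t by (simp add: odd_part_eq[OF p] halves_shift[OF t(2)] t(6))
qed

lemma thread_iff:
  "even_thread \<alpha> \<longleftrightarrow> (\<exists>\<pi>. odd_snow_leopard \<pi> \<and> \<alpha> = evens \<pi>)"
  "odd_thread \<beta> \<longleftrightarrow> (\<exists>\<pi>. odd_snow_leopard \<pi> \<and> \<beta> = odds \<pi>)"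
  by (auto simp: even_thread_def odd_thread_def odd_snow_leopard_def)

theorem theorem3p8:
  "(\<forall>\<alpha>. extended_perm \<alpha> \<longrightarrow>
      (even_thread \<alpha> \<and> plength \<alpha> \<ge> 0 \<longleftrightarrow>
        (\<exists>\<alpha>\<^sub>1 \<beta>\<^sub>1. even_thread \<alpha>\<^sub>1 \<and> odd_thread \<beta>\<^sub>1 \<and>
           \<alpha> = complement \<beta>\<^sub>1 \<ominus> (one_perm \<ominus> \<alpha>\<^sub>1)))) \<and>
   (\<forall>\<beta>. extended_perm \<beta> \<longrightarrow>
      (odd_thread \<beta> \<and> plength \<beta> > 0 \<longleftrightarrow>
        (\<exists>\<alpha>\<^sub>2 \<beta>\<^sub>2. even_thread \<alpha>\<^sub>2 \<and> odd_thread \<beta>\<^sub>2 \<and>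
           \<beta> = ((one_perm \<oplus> complement \<alpha>\<^sub>2) \<oplus> one_perm) \<ominus> \<beta>\<^sub>2)))"
proof (intro conjI allI impI iffI)
  fix \<alpha> assume "even_thread \<alpha> \<and> plength \<alpha> \<ge> 0"
  then obtain \<pi> where \<pi>: "odd_snow_leopard \<pi>" "\<alpha> = evens \<pi>" and "plength \<alpha> \<ge> 0"
    unfolding thread_iff by blast
  then obtain s where s: "\<pi> = Perm s" by (cases \<pi>) auto
  obtain \<pi>\<^sub>1 \<pi>\<^sub>2 where "odd_snow_leopard \<pi>\<^sub>1" "odd_snow_leopard \<pi>\<^sub>2" "\<pi> = frame \<pi>\<^sub>1 \<ominus> (one_perm \<ominus> \<pi>\<^sub>2)"
    using odd_snow_leopard_decompose \<pi>(1) unfolding s by metis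
  then show "\<exists>\<alpha>\<^sub>1 \<beta>\<^sub>1. even_thread \<alpha>\<^sub>1 \<and> odd_thread \<beta>\<^sub>1 \<and> \<alpha> = complement \<beta>\<^sub>1 \<ominus> (one_perm \<ominus> \<alpha>\<^sub>1)"
    using threads_of_composition(1) \<pi>(2) unfolding thread_iff by blast
next
  fix \<alpha> assume "\<exists>\<alpha>\<^sub>1 \<beta>\<^sub>1. even_thread \<alpha>\<^sub>1 \<and> odd_thread \<beta>\<^sub>1 \<and> \<alpha> = complement \<beta>\<^sub>1 \<ominus> (one_perm \<ominus> \<alpha>\<^sub>1)"
  then obtain \<pi>\<^sub>1 \<pi>\<^sub>2 where \<pi>: "odd_snow_leopard \<pi>\<^sub>1" "odd_snow_leopard \<pi>\<^sub>2"
    and \<alpha>: "\<alpha> = complement (odds \<pi>\<^sub>1) \<ominus> (one_perm \<ominus> evens \<pi>\<^sub>2)"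
    unfolding thread_iff by blast
  have "even_thread \<alpha>"
    unfolding thread_iff \<alpha> using odd_snow_leopard_compose[OF \<pi>] threads_of_composition(1)[OF \<pi>] by metis
  moreover obtain t where "one_perm \<ominus> evens \<pi>\<^sub>2 = Perm t" using threads_of_lower_block[OF \<pi>(2)] by metis
  moreover obtain x where "complement (odds \<pi>\<^sub>1) = Perm x" using threads_of_frame[OF \<pi>(1)] by metis
  ultimately show "even_thread \<alpha>" "plength \<alpha> \<ge> 0" unfolding \<alpha> by simp_all
next
  fix \<beta> assume "odd_thread \<beta> \<and> plength \<beta> > 0"
  then obtain \<pi> where \<pi>: "odd_snow_leopard \<pi>" "\<beta> = odds \<pi>" and "plength \<beta> > 0"
    unfolding thread_iff by blast
  then obtain s where s: "\<pi> = Perm s" by (cases \<pi>) auto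
  obtain \<pi>\<^sub>1 \<pi>\<^sub>2 where "odd_snow_leopard \<pi>\<^sub>1" "odd_snow_leopard \<pi>\<^sub>2" "\<pi> = frame \<pi>\<^sub>1 \<ominus> (one_perm \<ominus> \<pi>\<^sub>2)"
    using odd_snow_leopard_decompose \<pi>(1) unfolding s by metis
  then show "\<exists>\<alpha>\<^sub>2 \<beta>\<^sub>2. even_thread \<alpha>\<^sub>2 \<and> odd_thread \<beta>\<^sub>2 \<and> \<beta> = frame \<alpha>\<^sub>2 \<ominus> \<beta>\<^sub>2"
    using threads_of_composition(2) \<pi>(2) unfolding thread_iff by blast
next
  fix \<beta> assume "\<exists>\<alpha>\<^sub>2 \<beta>\<^sub>2. even_thread \<alpha>\<^sub>2 \<and> odd_thread \<beta>\<^sub>2 \<and> \<beta> = frame \<alpha>\<^sub>2 \<ominus> \<beta>\<^sub>2"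
  then obtain \<pi>\<^sub>1 \<pi>\<^sub>2 where \<pi>: "odd_snow_leopard \<pi>\<^sub>1" "odd_snow_leopard \<pi>\<^sub>2"
    and \<beta>: "\<beta> = frame (evens \<pi>\<^sub>1) \<ominus> odds \<pi>\<^sub>2"
    unfolding thread_iff by blast
  have \<beta>': "\<beta> = odds (frame \<pi>\<^sub>1 \<ominus> (one_perm \<ominus> \<pi>\<^sub>2))" using threads_of_composition(2)[OF \<pi>] \<beta> by simp
  then show "odd_thread \<beta>" unfolding thread_iff using odd_snow_leopard_compose[OF \<pi>] by blast
  obtain x t where xt: "frame \<pi>\<^sub>1 = Perm x" "one_perm \<ominus> \<pi>\<^sub>2 = Perm t"
    using threads_of_frame[OF \<pi>(1)] threads_of_lower_block[OF \<pi>(2)] by metis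
  have c: "odd_snow_leopard (Perm (map (\<lambda>v. length t + v) x @ t))"
    using odd_snow_leopard_compose[OF \<pi>] unfolding xt by simp
  note p = odd_snow_leopard_is_perm[OF c]
  show "plength \<beta> > 0"
    unfolding \<beta>' xt using length_halves(2)[OF p(1)] p(2) odd_pos[OF p(2)] by (simp add: odd_part_eq[OF p(1)])
qed

end
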